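(* Let $\Sigma$ be a closed connected oriented surface, let $L\subset\Sigma\times I$ be an oriented link with $\mu$ components and link group $G_L$, and let $F(\mu)$ be the free group generated by $x_1,\ldots,x_\mu$. Then for every integer $n\ge 1$ the nilpotent quotient $G_L/(G_L)_n$ has the presentation $$\left\langle x_1,\ldots,x_\mu \;\middle|\; [x_1,\ell_{1,n}],\ldots,[x_\mu,\ell_{\mu,n}],\,F(\mu)_n\right\rangle,$$ where $x_i$ and $\ell_{i,n}$ represent the images in $G_L/(G_L)_n$ of the $i$-th meridian and the $i$-th longitude, respectively (so $\ell_{i,n}$ is a word in $x_1,\dots,x_\mu$ representing the image of the $i$-th longitude).
   Context: Here $I=[0,1]$. For a group $G$, the lower central series is $G_1=G$, $G_n=[G,G_{n-1}]$ for $n\ge2$. Link group: for $L\subset\Sigma\times I$, $G_L=\pi_1\big((\Sigma\times I\smallsetminus L)/\Sigma\times\{1\}\big)$, where $\Sigma\times\{1\}$ is collapsed to a point. Equivalently, it is given by the Wirtinger presentation of a diagram of $L$ on $\Sigma$ (or of the associated virtual link diagram): on the $i$-th component, which passes through $n_i$ undercrossings, label the arcs (running from undercrossing to undercrossing) consecutively $a_{i1},\dots,a_{in_i}$ (second index modulo $n_i$; a component without undercrossings contributes a single generator and no relation). Then $$G_L=\langle a_{ij}\mid a_{i\,j+1}=a_{k\ell}^{-\varepsilon_{ij}}\,a_{ij}\,a_{k\ell}^{\varepsilon_{ij}}\rangle,$$ with one relation for each undercrossing, where $a_{ij}$ and $a_{i\,j+1}$ are the incoming and outgoing undercrossing arcs,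 $a_{k\ell}$ is the overcrossing arc, and $\varepsilon_{ij}=\pm1$ is the sign of the crossing. Meridians and longitudes: for each $i$ choose one arc of the $i$-th component; the meridian $m_i\in G_L$ is the corresponding generator. The longitude $\ell_i$ is the word obtained by following the $i$-th component in the direction of its orientation, starting at the chosen arc, and recording at each undercrossing the overcrossing arc generator raised to the power given by the sign of that crossing; the word is then multiplied by a power of $m_i$ so that its total exponent sum in the generators of the $i$-th component is zero. *)

theory Defs
  imports "HOL-Analysis.Analysis" "HOL-Algebra.Generated_Groups" "HOL-Algebra.Coset"
begin

section \<open>Words and group presentations\<close>

text \<open>The letter \<open>(x, True)\<close> stands for \<open>x\<close> and \<open>(x, False)\<close> for its inverse.\<close>

type_synonym 'x word = "('x \<times> bool) list"

definition words :: "'x set \<Rightarrow> 'x word set" where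
  "words S = lists (S \<times> UNIV)"

definition word_inv :: "'x word \<Rightarrow> 'x word" where
  "word_inv w = rev (map (\<lambda>(x, e). (x, \<not> e)) w)"

definition gen_pow :: "'x \<Rightarrow> int \<Rightarrow> 'x word" where
  "gen_pow x k = replicate (nat \<bar>k\<bar>) (x, 0 \<le> k)"

definition word_comm :: "'x word \<Rightarrow> 'x word \<Rightarrow> 'x word" where
  "word_comm u v = u @ v @ word_inv u @ word_inv v"

definition exponent_sum :: "'x set \<Rightarrow> 'x word \<Rightarrow> int" where
  "exponent_sum T w = (\<Sum>(x, e)\<leftarrow>w. if x \<in> T then (if e then 1 else - 1) else 0)"

text \<open>Two words over \<open>S\<close> are related iff they represent the same element of the group with
  generators \<open>S\<close> and relators \<open>R\<close> (it is assumed that \<open>R \<subseteq> words S\<close>).\<close>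

inductive pres_eq :: "'x set \<Rightarrow> 'x word set \<Rightarrow> 'x word \<Rightarrow> 'x word \<Rightarrow> bool"
  for S :: "'x set" and R :: "'x word set" where
  pres_refl: "w \<in> words S \<Longrightarrow> pres_eq S R w w"
| pres_sym: "pres_eq S R u v \<Longrightarrow> pres_eq S R v u"
| pres_trans: "pres_eq S R u v \<Longrightarrow> pres_eq S R v w \<Longrightarrow> pres_eq S R u w"
| pres_cancel: "u \<in> words S \<Longrightarrow> v \<in> words S \<Longrightarrow> x \<in> S \<Longrightarrow>
    pres_eq S R (u @ [(x, e), (x, \<not> e)] @ v) (u @ v)"
| pres_relator: "u \<in> words S \<Longrightarrow> v \<in> words S \<Longrightarrow> r \<in> R \<Longrightarrow> pres_eq S R (u @ r @ v) (u @ v)"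

definition word_class :: "'x set \<Rightarrow> 'x word set \<Rightarrow> 'x word \<Rightarrow> 'x word set" where
  "word_class S R w = {v. pres_eq S R w v}"

definition presented_group :: "'x set \<Rightarrow> 'x word set \<Rightarrow> 'x word set monoid" where
  "presented_group S R =
    \<lparr>carrier = word_class S R ` words S,
     mult = (\<lambda>A B. \<Union>u\<in>A. \<Union>v\<in>B. word_class S R (u @ v)),
     one = word_class S R []\<rparr>"

definition free_group :: "'x set \<Rightarrow> 'x word set monoid" where
  "free_group S = presented_group S {}"

definition word_eval :: "('a, 'b) monoid_scheme \<Rightarrow> ('x \<Rightarrow> 'a) \<Rightarrow> 'x word \<Rightarrow> 'a" where
  "word_eval G f w =
    foldr (\<lambda>(x, e) g. (if e then f x else inv\<^bsub>G\<^esub> f x) \<otimes>\<^bsub>G\<^esub> g) w \<one>\<^bsub>G\<^esub>"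

text \<open>The numbering starts at 1; the value at 0 is irrelevant.\<close>

fun lower_central :: "('a, 'b) monoid_scheme \<Rightarrow> nat \<Rightarrow> 'a set" where
  "lower_central G 0 = carrier G"
| "lower_central G (Suc 0) = carrier G"
| "lower_central G (Suc (Suc n)) =
    generate G (\<Union>g\<in>carrier G. \<Union>h\<in>lower_central G (Suc n).
      {g \<otimes>\<^bsub>G\<^esub> h \<otimes>\<^bsub>G\<^esub> inv\<^bsub>G\<^esub> g \<otimes>\<^bsub>G\<^esub> inv\<^bsub>G\<^esub> h})"


section \<open>Closed oriented surfaces\<close>

text \<open>A surface is a topological space \<open>X\<close> with an atlas \<open>A\<close> of pairs \<open>(U, \<phi>)\<close>. The orientation is
  encoded in the atlas: coordinate changes are \<open>C\<^sup>1\<close> with positive Jacobian. Every topological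
  oriented surface carries such an atlas. The differentiable structure serves only to speak of
  transverse crossings and of their signs.\<close>

definition oriented_atlas :: "'a topology \<Rightarrow> ('a set \<times> ('a \<Rightarrow> real^2)) set \<Rightarrow> bool" where
  "oriented_atlas X A \<longleftrightarrow>
    topspace X = (\<Union>(U, \<phi>)\<in>A. U) \<and>
    (\<forall>(U, \<phi>)\<in>A. openin X U \<and> open (\<phi> ` U) \<and>
       homeomorphic_map (subtopology X U) (top_of_set (\<phi> ` U)) \<phi>) \<and>
    (\<forall>(U, \<phi>)\<in>A. \<forall>(V, \<psi>)\<in>A. \<exists>J :: real^2 \<Rightarrow> real^2^2.
       continuous_on (\<phi> ` (U \<inter> V)) J \<and>
       (\<forall>z\<in>\<phi> ` (U \<inter> V).
          ((\<psi> \<circ> inv_into U \<phi>) has_derivative (\<lambda>v. J z *v v)) (at z) \<and> det (J z) > 0))"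

definition closed_connected_oriented_surface ::
    "'a topology \<Rightarrow> ('a set \<times> ('a \<Rightarrow> real^2)) set \<Rightarrow> bool" where
  "closed_connected_oriented_surface X A \<longleftrightarrow>
    topspace X \<noteq> {} \<and> compact_space X \<and> Hausdorff_space X \<and> connected_space X \<and>
    oriented_atlas X A"


section \<open>Links in thickened surfaces and their diagrams\<close>

definition thickening :: "'a topology \<Rightarrow> ('a \<times> real) topology" where
  "thickening X = prod_topology X (top_of_set {0..1})"

text \<open>The components are numbered \<open>0, \<dots>, \<mu> - 1\<close>. The \<open>i\<close>-th one is the simple closed curve \<open>L i\<close>,
  given with period 1 and oriented by increasing parameter.\<close>

definition oriented_link :: "'a topology \<Rightarrow> nat \<Rightarrow> (nat \<Rightarrow> real \<Rightarrow> 'a \<times> real) \<Rightarrow> bool" where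
  "oriented_link X \<mu> L \<longleftrightarrow>
    (\<forall>i<\<mu>. continuous_map euclideanreal (thickening X) (L i) \<and> (\<forall>t. L i (t + 1) = L i t)) \<and>
    (\<forall>i<\<mu>. \<forall>j<\<mu>. \<forall>s t. L i s = L j t \<longrightarrow> i = j \<and> s - t \<in> \<int>)"

definition ambient_isotopic ::
    "'a topology \<Rightarrow> nat \<Rightarrow> (nat \<Rightarrow> real \<Rightarrow> 'a \<times> real) \<Rightarrow> (nat \<Rightarrow> real \<Rightarrow> 'a \<times> real) \<Rightarrow> bool" where
  "ambient_isotopic X \<mu> L L' \<longleftrightarrow>
    (\<exists>H :: real \<Rightarrow> 'a \<times> real \<Rightarrow> 'a \<times> real.
       continuous_map (prod_topology (top_of_set {0..1}) (thickening X)) (thickening X)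
         (\<lambda>(s, y). H s y) \<and>
       (\<forall>s\<in>{0..1}. homeomorphic_map (thickening X) (thickening X) (H s)) \<and>
       (\<forall>y\<in>topspace (thickening X). H 0 y = y) \<and>
       (\<forall>i<\<mu>. \<forall>t. H 1 (L i t) = L' i t))"

definition shadow :: "(nat \<Rightarrow> real \<Rightarrow> 'a \<times> real) \<Rightarrow> nat \<Rightarrow> real \<Rightarrow> 'a" where
  "shadow D i t = fst (D i t)"

definition height :: "(nat \<Rightarrow> real \<Rightarrow> 'a \<times> real) \<Rightarrow> nat \<Rightarrow> real \<Rightarrow> real" where
  "height D i t = snd (D i t)"

definition tangent ::
    "('a \<Rightarrow> real^2) \<Rightarrow> (nat \<Rightarrow> real \<Rightarrow> 'a \<times> real) \<Rightarrow> nat \<Rightarrow> real \<Rightarrow> real^2" where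
  "tangent \<phi> D i t = vector_derivative (\<phi> \<circ> shadow D i) (at t)"

text \<open>Each point of the \<open>\<mu>\<close> components is given by exactly one of these parameters.\<close>

definition params :: "nat \<Rightarrow> (nat \<times> real) set" where
  "params \<mu> = {..<\<mu>} \<times> {0..<1}"

definition double_points ::
    "nat \<Rightarrow> (nat \<Rightarrow> real \<Rightarrow> 'a \<times> real) \<Rightarrow> ((nat \<times> real) \<times> (nat \<times> real)) set" where
  "double_points \<mu> D =
    {((i, s), (k, t)). (i, s) \<in> params \<mu> \<and> (k, t) \<in> params \<mu> \<and> (i, s) \<noteq> (k, t) \<and>
       shadow D i s = shadow D k t}"

text \<open>A diagram on \<open>X\<close> is represented by a link \<open>D\<close> in general position with respect to the
  projection \<open>X \<times> [0,1] \<rightarrow> X\<close>: the projection is an immersion whose only multiple points are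
  finitely many transverse double points.\<close>

definition regular_diagram ::
    "'a topology \<Rightarrow> ('a set \<times> ('a \<Rightarrow> real^2)) set \<Rightarrow> nat \<Rightarrow> (nat \<Rightarrow> real \<Rightarrow> 'a \<times> real) \<Rightarrow> bool" where
  "regular_diagram X A \<mu> D \<longleftrightarrow>
    oriented_link X \<mu> D \<and>
    (\<forall>(U, \<phi>)\<in>A. \<forall>i<\<mu>.
       (\<phi> \<circ> shadow D i) C1_differentiable_on {t. shadow D i t \<in> U} \<and>
       (\<forall>t. shadow D i t \<in> U \<longrightarrow> tangent \<phi> D i t \<noteq> 0)) \<and>
    finite (double_points \<mu> D) \<and>
    (\<forall>p q r. (p, q) \<in> double_points \<mu> D \<and> (p, r) \<in> double_points \<mu> D \<longrightarrow> q = r) \<and>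
    (\<forall>((i, s), (k, t))\<in>double_points \<mu> D. \<forall>(U, \<phi>)\<in>A. shadow D i s \<in> U \<longrightarrow>
       det (vector [tangent \<phi> D i s, tangent \<phi> D k t] :: real^2^2) \<noteq> 0)"

definition diagram_of ::
    "'a topology \<Rightarrow> ('a set \<times> ('a \<Rightarrow> real^2)) set \<Rightarrow> nat \<Rightarrow>
     (nat \<Rightarrow> real \<Rightarrow> 'a \<times> real) \<Rightarrow> (nat \<Rightarrow> real \<Rightarrow> 'a \<times> real) \<Rightarrow> bool" where
  "diagram_of X A \<mu> L D \<longleftrightarrow> regular_diagram X A \<mu> D \<and> ambient_isotopic X \<mu> L D"


section \<open>Arcs, overcrossing arcs and signs\<close>

definition undercrossings :: "nat \<Rightarrow> (nat \<Rightarrow> real \<Rightarrow> 'a \<times> real) \<Rightarrow> nat \<Rightarrow> real set" where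
  "undercrossings \<mu> D i =
    {s. \<exists>k t. ((i, s), (k, t)) \<in> double_points \<mu> D \<and> height D i s < height D k t}"

definition num_under :: "nat \<Rightarrow> (nat \<Rightarrow> real \<Rightarrow> 'a \<times> real) \<Rightarrow> nat \<Rightarrow> nat" where
  "num_under \<mu> D i = card (undercrossings \<mu> D i)"

definition under_param :: "nat \<Rightarrow> (nat \<Rightarrow> real \<Rightarrow> 'a \<times> real) \<Rightarrow> nat \<Rightarrow> nat \<Rightarrow> real" where
  "under_param \<mu> D i j = sorted_list_of_set (undercrossings \<mu> D i) ! j"

text \<open>Arc \<open>(i, j)\<close> of component \<open>i\<close> ends at the \<open>j\<close>-th undercrossing of that component, counted
  from 0 in the order of \<open>[0,1)\<close>; the next arc is \<open>(i, (j + 1) mod n\<^sub>i)\<close>. A component without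
  undercrossings has the single arc \<open>(i, 0)\<close>.\<close>

definition arcs :: "nat \<Rightarrow> (nat \<Rightarrow> real \<Rightarrow> 'a \<times> real) \<Rightarrow> (nat \<times> nat) set" where
  "arcs \<mu> D = {(i, j). i < \<mu> \<and> j < max 1 (num_under \<mu> D i)}"

text \<open>The arc through the parameter \<open>t\<close> of component \<open>k\<close>. Parameters past the last undercrossing
  lie on arc 0, and for a component without undercrossings this is \<open>0 mod 0 = 0\<close>.\<close>

definition arc_at :: "nat \<Rightarrow> (nat \<Rightarrow> real \<Rightarrow> 'a \<times> real) \<Rightarrow> nat \<Rightarrow> real \<Rightarrow> nat \<times> nat" where
  "arc_at \<mu> D k t = (k, card {u \<in> undercrossings \<mu> D k. u < t} mod num_under \<mu> D k)"

definition over_strand :: "nat \<Rightarrow> (nat \<Rightarrow> real \<Rightarrow> 'a \<times> real) \<Rightarrow> nat \<Rightarrow> nat \<Rightarrow> nat \<times> real" where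
  "over_strand \<mu> D i j = (THE q. ((i, under_param \<mu> D i j), q) \<in> double_points \<mu> D)"

definition over_arc :: "nat \<Rightarrow> (nat \<Rightarrow> real \<Rightarrow> 'a \<times> real) \<Rightarrow> nat \<Rightarrow> nat \<Rightarrow> nat \<times> nat" where
  "over_arc \<mu> D i j = (case over_strand \<mu> D i j of (k, t) \<Rightarrow> arc_at \<mu> D k t)"

text \<open>A crossing is positive iff the tangent vectors (over strand, under strand) form a positive
  basis. As the atlas is oriented, this does not depend on the chart.\<close>

definition crossing_sign ::
    "('a set \<times> ('a \<Rightarrow> real^2)) set \<Rightarrow> nat \<Rightarrow> (nat \<Rightarrow> real \<Rightarrow> 'a \<times> real) \<Rightarrow> nat \<Rightarrow> nat \<Rightarrow> int" where
  "crossing_sign A \<mu> D i j =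
    (case over_strand \<mu> D i j of (k, t) \<Rightarrow>
       if \<exists>(U, \<phi>)\<in>A. shadow D k t \<in> U \<and>
            det (vector [tangent \<phi> D k t, tangent \<phi> D i (under_param \<mu> D i j)] :: real^2^2) > 0
       then 1 else - 1)"


section \<open>Link group, meridians and longitudes\<close>

definition wirtinger_relator ::
    "('a set \<times> ('a \<Rightarrow> real^2)) set \<Rightarrow> nat \<Rightarrow> (nat \<Rightarrow> real \<Rightarrow> 'a \<times> real) \<Rightarrow> nat \<Rightarrow> nat \<Rightarrow>
     (nat \<times> nat) word" where
  "wirtinger_relator A \<mu> D i j =
    [((i, (j + 1) mod num_under \<mu> D i), True)] @
    word_inv (gen_pow (over_arc \<mu> D i j) (- crossing_sign A \<mu> D i j) @ [((i, j), True)] @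
              gen_pow (over_arc \<mu> D i j) (crossing_sign A \<mu> D i j))"

definition wirtinger_relators ::
    "('a set \<times> ('a \<Rightarrow> real^2)) set \<Rightarrow> nat \<Rightarrow> (nat \<Rightarrow> real \<Rightarrow> 'a \<times> real) \<Rightarrow> (nat \<times> nat) word set" where
  "wirtinger_relators A \<mu> D = {wirtinger_relator A \<mu> D i j | i j. i < \<mu> \<and> j < num_under \<mu> D i}"

definition link_group ::
    "('a set \<times> ('a \<Rightarrow> real^2)) set \<Rightarrow> nat \<Rightarrow> (nat \<Rightarrow> real \<Rightarrow> 'a \<times> real) \<Rightarrow> (nat \<times> nat) word set monoid"
  where "link_group A \<mu> D = presented_group (arcs \<mu> D) (wirtinger_relators A \<mu> D)"

text \<open>\<open>b i\<close> is the second index of the arc chosen on the \<open>i\<close>-th component.\<close>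

definition meridian ::
    "('a set \<times> ('a \<Rightarrow> real^2)) set \<Rightarrow> nat \<Rightarrow> (nat \<Rightarrow> real \<Rightarrow> 'a \<times> real) \<Rightarrow> (nat \<Rightarrow> nat) \<Rightarrow> nat \<Rightarrow>
     (nat \<times> nat) word set" where
  "meridian A \<mu> D b i = word_class (arcs \<mu> D) (wirtinger_relators A \<mu> D) [((i, b i), True)]"

definition blackboard_longitude ::
    "('a set \<times> ('a \<Rightarrow> real^2)) set \<Rightarrow> nat \<Rightarrow> (nat \<Rightarrow> real \<Rightarrow> 'a \<times> real) \<Rightarrow> (nat \<Rightarrow> nat) \<Rightarrow> nat \<Rightarrow>
     (nat \<times> nat) word" where
  "blackboard_longitude A \<mu> D b i =
    concat (map (\<lambda>r. let j = (b i + r) mod num_under \<mu> D i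
                     in gen_pow (over_arc \<mu> D i j) (crossing_sign A \<mu> D i j))
      [0..<num_under \<mu> D i])"

definition longitude_word ::
    "('a set \<times> ('a \<Rightarrow> real^2)) set \<Rightarrow> nat \<Rightarrow> (nat \<Rightarrow> real \<Rightarrow> 'a \<times> real) \<Rightarrow> (nat \<Rightarrow> nat) \<Rightarrow> nat \<Rightarrow>
     (nat \<times> nat) word" where
  "longitude_word A \<mu> D b i =
    blackboard_longitude A \<mu> D b i @
    gen_pow (i, b i) (- exponent_sum {a. fst a = i} (blackboard_longitude A \<mu> D b i))"

definition longitude ::
    "('a set \<times> ('a \<Rightarrow> real^2)) set \<Rightarrow> nat \<Rightarrow> (nat \<Rightarrow> real \<Rightarrow> 'a \<times> real) \<Rightarrow> (nat \<Rightarrow> nat) \<Rightarrow> nat \<Rightarrow>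
     (nat \<times> nat) word set" where
  "longitude A \<mu> D b i =
    word_class (arcs \<mu> D) (wirtinger_relators A \<mu> D) (longitude_word A \<mu> D b i)"


section \<open>The nilpotent quotients\<close>

definition nilpotent_quotient :: "('a, 'b) monoid_scheme \<Rightarrow> nat \<Rightarrow> 'a set monoid" where
  "nilpotent_quotient G n = G Mod lower_central G n"

definition quotient_image :: "('a, 'b) monoid_scheme \<Rightarrow> nat \<Rightarrow> 'a \<Rightarrow> 'a set" where
  "quotient_image G n g = lower_central G n #>\<^bsub>G\<^esub> g"

text \<open>The words \<open>l i\<close> in the generators \<open>x\<^sub>0, \<dots>, x\<^bsub>\<mu>-1\<^esub>\<close> of the free group, evaluated at the images
  of the meridians, give the images of the longitudes.\<close>

definition represents_longitudes ::
    "('a set \<times> ('a \<Rightarrow> real^2)) set \<Rightarrow> nat \<Rightarrow> (nat \<Rightarrow> real \<Rightarrow> 'a \<times> real) \<Rightarrow> (nat \<Rightarrow> nat) \<Rightarrow> nat \<Rightarrow>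
     (nat \<Rightarrow> nat word) \<Rightarrow> bool" where
  "represents_longitudes A \<mu> D b n l \<longleftrightarrow>
    (\<forall>i<\<mu>. l i \<in> words {..<\<mu>} \<and>
       word_eval (nilpotent_quotient (link_group A \<mu> D) n)
         (\<lambda>k. quotient_image (link_group A \<mu> D) n (meridian A \<mu> D b k)) (l i)
       = quotient_image (link_group A \<mu> D) n (longitude A \<mu> D b i))"

definition milnor_relators :: "nat \<Rightarrow> nat \<Rightarrow> (nat \<Rightarrow> nat word) \<Rightarrow> nat word set" where
  "milnor_relators \<mu> n l =
    {word_comm [(i, True)] (l i) | i. i < \<mu>} \<union>
    {w \<in> words {..<\<mu>}. word_class {..<\<mu>} {} w \<in> lower_central (free_group {..<\<mu>}) n}"

end

theory Submission
  imports Defs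
begin

text \<open>In the link group, every arc of component \<open>i\<close> is the conjugate of the meridian \<open>x\<^sub>i\<close> by the
  partial longitude from the base arc to it. Read as a recursion for the arcs in an arbitrary group
  \<open>P\<close> with elements \<open>x\<^sub>i\<close>, these equations are contracting for the lower central series: if two
  assignments agree modulo \<open>P\<^sub>k\<close>, their updates agree modulo \<open>P\<^bsub>k+1\<^esub>\<close>. Hence they have a unique
  solution in every nilpotent group. In the nilpotent quotient of the link group, uniqueness puts
  the arcs into the subgroup generated by the meridians. In the group \<open>P\<close> with Milnor's presentation
  there is a solution \<open>e\<close>, and it satisfies all Wirtinger relations provided \<open>x\<^sub>i\<close> commutes with the
  value of the \<open>i\<close>-th longitude under \<open>e\<close>. By induction on \<open>k\<close> this holds modulo \<open>P\<^sub>k\<close>: if it does,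
  \<open>e\<close> induces a homomorphism from the link group to \<open>P / P\<^sub>k\<close>, so the longitude under \<open>e\<close> agrees with
  \<open>l\<^sub>i\<close> modulo \<open>P\<^sub>k\<close>, and since \<open>x\<^sub>i\<close> commutes with \<open>l\<^sub>i\<close>, the relation holds modulo \<open>P\<^bsub>k+1\<^esub>\<close>. The
  resulting homomorphism from the link group to \<open>P\<close> inverts the evident one.\<close>


section \<open>Words\<close>

lemma Nil_in_words [simp]: "[] \<in> words S"
  by (simp add: words_def)

lemma Cons_in_words [simp]: "p # w \<in> words S \<longleftrightarrow> fst p \<in> S \<and> w \<in> words S"
  by (cases p) (simp add: words_def)

lemma append_in_words [simp]: "u @ v \<in> words S \<longleftrightarrow> u \<in> words S \<and> v \<in> words S"
  by (simp add: words_def)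

lemma word_inv_in_words [simp]: "word_inv w \<in> words S \<longleftrightarrow> w \<in> words S"
  by (auto simp: words_def word_inv_def in_lists_conv_set)

lemma gen_pow_in_words [simp]: "x \<in> S \<Longrightarrow> gen_pow x k \<in> words S"
  by (auto simp: words_def gen_pow_def)

lemma word_comm_in_words [simp]: "u \<in> words S \<Longrightarrow> v \<in> words S \<Longrightarrow> word_comm u v \<in> words S"
  by (simp add: word_comm_def)

lemma word_inv_Nil [simp]: "word_inv [] = []"
  by (simp add: word_inv_def)

lemma word_inv_Cons: "word_inv ((x, e) # w) = word_inv w @ [(x, \<not> e)]"
  by (simp add: word_inv_def)

section \<open>Evaluation of words in a group\<close>

context group
begin

lemma word_eval_Nil [simp]: "word_eval G f [] = \<one>"
  by (simp add: word_eval_def)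

lemma word_eval_Cons:
  "word_eval G f ((x, e) # w) = (if e then f x else inv (f x)) \<otimes> word_eval G f w"
  by (simp add: word_eval_def)

text \<open>Taking \<open>K\<close> to be the whole carrier gives closure. The general form is what
  later keeps the arcs inside the subgroup generated by the meridians.\<close>

lemma word_eval_in_subgroup:
  assumes "subgroup K G" and "\<And>x. x \<in> S \<Longrightarrow> f x \<in> K" and "w \<in> words S"
  shows "word_eval G f w \<in> K"
  using assms(3)
proof (induction w)
  case Nil
  then show ?case
    using assms(1) by (simp add: subgroup.one_closed)
next
  case (Cons p w)
  then show ?case
    using assms(1,2)
    by (cases p) (auto simp: word_eval_Cons subgroup.m_closed subgroup.m_inv_closed)
qed

lemma word_eval_closed: "f \<in> S \<rightarrow> carrier G \<Longrightarrow> w \<in> words S \<Longrightarrow> word_eval G f w \<in> carrier G"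
  by (rule word_eval_in_subgroup[OF subgroup_self]) auto

lemma word_eval_append:
  assumes "f \<in> S \<rightarrow> carrier G" "u \<in> words S" "v \<in> words S"
  shows "word_eval G f (u @ v) = word_eval G f u \<otimes> word_eval G f v"
  using assms(2)
proof (induction u)
  case Nil
  then show ?case
    using assms by (simp add: word_eval_closed[of f S])
next
  case (Cons p u)
  moreover obtain x e where "p = (x, e)"
    by force
  moreover have "f x \<in> carrier G"
    using Cons.prems assms(1) \<open>p = (x, e)\<close> by auto
  ultimately show ?case
    using assms by (auto simp: word_eval_Cons m_assoc word_eval_closed[of f S])
qed

lemma word_eval_single: "f x \<in> carrier G \<Longrightarrow> word_eval G f [(x, True)] = f x"
  by (simp add: word_eval_Cons)

lemma word_eval_word_inv:
  assumes "f \<in> S \<rightarrow> carrier G" "w \<in> words S"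
  shows "word_eval G f (word_inv w) = inv (word_eval G f w)"
  using assms(2)
proof (induction w)
  case Nil
  then show ?case
    by simp
next
  case (Cons p w)
  moreover obtain x e where "p = (x, e)"
    by force
  moreover have "f x \<in> carrier G"
    using Cons.prems assms(1) \<open>p = (x, e)\<close> by auto
  ultimately show ?case
    using assms by (auto simp: word_inv_Cons word_eval_Cons word_eval_append[of f S]
        inv_mult_group word_eval_closed[of f S])
qed

lemma word_eval_gen_pow:
  assumes "f x \<in> carrier G"
  shows "word_eval G f (gen_pow x k) = f x [^] k"
proof -
  have "word_eval G f (replicate m (x, e)) = (if e then f x else inv (f x)) [^] m" for m :: nat and e
    using assms by (induction m)
      (auto simp: word_eval_Cons nat_pow_Suc2[symmetric] simp del: nat_pow_Suc)
  note eval_replicate = this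
  show ?thesis
  proof (cases "0 \<le> k")
    case True
    then obtain m where k: "k = int m"
      by (metis nonneg_int_cases)
    show ?thesis
      unfolding k int_pow_int by (simp add: gen_pow_def eval_replicate)
  next
    case False
    then obtain m where k: "k = - int m" "m > 0"
      by (metis linorder_not_le neg_int_cases)
    then have "gen_pow x k = replicate m (x, False)"
      by (simp add: gen_pow_def)
    then show ?thesis
      using assms by (simp add: eval_replicate k int_pow_neg_int nat_pow_inv)
  qed
qed

text \<open>The commutator evaluates to \<open>ab\<close> times the inverse of \<open>ba\<close>.
  Milnor's relators are used in this commuting form both in the quotient of the link group and in
  the presented group.\<close>

lemma word_eval_word_comm_eq_one_iff:
  assumes "f \<in> S \<rightarrow> carrier G" "u \<in> words S" "v \<in> words S"
  shows "word_eval G f (word_comm u v) = \<one> \<longleftrightarrow>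
    word_eval G f u \<otimes> word_eval G f v = word_eval G f v \<otimes> word_eval G f u"
proof -
  define a b where ab: "a = word_eval G f u" "b = word_eval G f v"
  have cl: "a \<in> carrier G" "b \<in> carrier G"
    using assms by (auto simp: ab word_eval_closed[of f S])
  have "word_eval G f (word_comm u v) = (a \<otimes> b) \<otimes> inv (b \<otimes> a)"
    using assms cl
    by (simp add: word_comm_def word_eval_append[of f S] word_eval_word_inv[of f S] ab
        inv_mult_group m_assoc)
  also have "\<dots> = \<one> \<longleftrightarrow> a \<otimes> b = b \<otimes> a"
    using cl inv_solve_right'[of \<one> "a \<otimes> b" "b \<otimes> a"] by auto
  finally show ?thesis
    by (simp add: ab)
qed

lemma word_eval_cong:
  assumes "\<And>x. x \<in> S \<Longrightarrow> f x = g x" "w \<in> words S"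
  shows "word_eval G f w = word_eval G g w"
  using assms(2) assms(1) by (induction w) (auto simp: word_eval_Cons)

text \<open>This is the subgroup generated by the values of \<open>f\<close>, described so that
  membership directly supplies a word.\<close>

lemma subgroup_word_eval_image:
  assumes "f \<in> S \<rightarrow> carrier G"
  shows "subgroup (word_eval G f ` words S) G"
proof (rule subgroupI)
  show "word_eval G f ` words S \<subseteq> carrier G" "word_eval G f ` words S \<noteq> {}"
    using assms by (auto intro: Nil_in_words simp: word_eval_closed[of f S])
next
  fix a assume "a \<in> word_eval G f ` words S"
  then obtain w where "w \<in> words S" "a = word_eval G f w"
    by auto
  then show "inv a \<in> word_eval G f ` words S"
    using assms by (intro image_eqI[of _ _ "word_inv w"]) (auto simp: word_eval_word_inv[of f S])
next
  fix a b assume "a \<in> word_eval G f ` words S" "b \<in> word_eval G f ` words S"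
  then obtain v w where "v \<in> words S" "a = word_eval G f v" "w \<in> words S" "b = word_eval G f w"
    by auto
  then show "a \<otimes> b \<in> word_eval G f ` words S"
    using assms by (intro image_eqI[of _ _ "v @ w"]) (auto simp: word_eval_append[of f S])
qed

end

lemma (in group_hom) hom_word_eval:
  assumes "f \<in> S \<rightarrow> carrier G" "w \<in> words S"
  shows "h (word_eval G f w) = word_eval H (\<lambda>x. h (f x)) w"
  using assms(2)
proof (induction w)
  case Nil
  then show ?case
    by simp
next
  case (Cons p w)
  moreover obtain x e where "p = (x, e)"
    by force
  moreover have "f x \<in> carrier G"
    using Cons.prems assms(1) \<open>p = (x, e)\<close> by auto
  ultimately show ?case
    using assms by (auto simp: G.word_eval_Cons H.word_eval_Cons G.word_eval_closed[of f S])
qed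


section \<open>Presented groups\<close>

text \<open>The assumption confines \<open>pres_eq\<close> to words over \<open>S\<close>; a relator
  with foreign letters could be inserted anywhere.\<close>

locale presentation =
  fixes S :: "'x set" and R :: "'x word set"
  assumes relators_in_words: "R \<subseteq> words S"
begin

lemma pres_eq_in_words: "pres_eq S R u v \<Longrightarrow> u \<in> words S \<and> v \<in> words S"
  by (induction rule: pres_eq.induct) (use relators_in_words in auto)

lemma pres_eq_context:
  assumes "pres_eq S R u v" "p \<in> words S" "q \<in> words S"
  shows "pres_eq S R (p @ u @ q) (p @ v @ q)"
  using assms(1)
proof (induction rule: pres_eq.induct)
  case (pres_refl w)
  then show ?case
    using assms by (simp add: pres_eq.pres_refl)
next
  case (pres_cancel u v x e)
  then show ?case
    using assms pres_eq.pres_cancel[of "p @ u" S "v @ q" x R e] by simp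
next
  case (pres_relator u v r)
  then show ?case
    using assms pres_eq.pres_relator[of "p @ u" S "v @ q" r R] by simp
next
  case (pres_sym u v)
  then show ?case
    by (simp add: pres_eq.pres_sym)
next
  case (pres_trans u v w)
  then show ?case
    using pres_eq.pres_trans by blast
qed

lemma word_class_eq_iff:
  assumes "u \<in> words S" "v \<in> words S"
  shows "word_class S R u = word_class S R v \<longleftrightarrow> pres_eq S R u v"
  unfolding word_class_def using assms by (blast intro: pres_refl dest: pres_sym pres_trans)

lemma word_class_self: "w \<in> words S \<Longrightarrow> w \<in> word_class S R w"
  by (simp add: word_class_def pres_refl)

lemma word_class_in_carrier [simp]:
  "w \<in> words S \<Longrightarrow> word_class S R w \<in> carrier (presented_group S R)"
  by (simp add: presented_group_def)

lemma carrier_presented_group: "carrier (presented_group S R) = word_class S R ` words S"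
  by (simp add: presented_group_def)

lemma one_presented_group: "\<one>\<^bsub>presented_group S R\<^esub> = word_class S R []"
  by (simp add: presented_group_def)

lemma word_class_append:
  assumes "u \<in> words S" "v \<in> words S"
  shows "word_class S R u \<otimes>\<^bsub>presented_group S R\<^esub> word_class S R v = word_class S R (u @ v)"
proof -
  have "word_class S R (u' @ v') = word_class S R (u @ v)"
    if "u' \<in> word_class S R u" "v' \<in> word_class S R v" for u' v'
  proof -
    have uv: "pres_eq S R u u'" "pres_eq S R v v'"
      using that by (auto simp: word_class_def)
    then have "u' \<in> words S" "v' \<in> words S"
      using pres_eq_in_words by auto
    then have "pres_eq S R (u @ v) (u' @ v')"
      using pres_eq_context[OF uv(1), of "[]" v] pres_eq_context[OF uv(2), of u' "[]"] assms
      by (auto intro: pres_trans)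
    then show ?thesis
      using assms \<open>u' \<in> words S\<close> \<open>v' \<in> words S\<close> by (simp add: word_class_eq_iff pres_sym)
  qed
  \<comment> \<open>All members of this union are the same class, and the union is nonempty because
    each class contains its own word.\<close>
  then have "(\<Union>u'\<in>word_class S R u. \<Union>v'\<in>word_class S R v. word_class S R (u' @ v'))
      = word_class S R (u @ v)"
    using word_class_self[OF assms(1)] word_class_self[OF assms(2)] by blast
  then show ?thesis
    by (simp add: presented_group_def)
qed

lemma pres_eq_word_inv: "w \<in> words S \<Longrightarrow> pres_eq S R (word_inv w @ w) []"
proof (induction w)
  case Nil
  then show ?case
    by (simp add: pres_refl)
next
  case (Cons p w)
  obtain x e where p: "p = (x, e)"
    by force
  \<comment> \<open>The pair to be cancelled starts with the inverse letter, so
    \<open>pres_cancel\<close> is applied at \<open>\<not> e\<close> and the double negation is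
    simplified afterwards.\<close>
  have "pres_eq S R (word_inv w @ [(x, \<not> e), (x, \<not> \<not> e)] @ w) (word_inv w @ w)"
    using Cons.prems p by (intro pres_cancel) auto
  then show ?case
    using Cons p by (auto simp: word_inv_Cons intro: pres_trans)
qed

sublocale presented: group "presented_group S R"
proof (rule groupI)
  fix a assume "a \<in> carrier (presented_group S R)"
  then obtain w where "w \<in> words S" "a = word_class S R w"
    by (auto simp: carrier_presented_group)
  then show "\<exists>b\<in>carrier (presented_group S R). b \<otimes>\<^bsub>presented_group S R\<^esub> a = \<one>\<^bsub>presented_group S R\<^esub>"
    by (intro bexI[of _ "word_class S R (word_inv w)"])
      (auto simp: word_class_append one_presented_group word_class_eq_iff pres_eq_word_inv)
qed (auto simp: carrier_presented_group one_presented_group word_class_append)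

lemma generator_in_carrier:
  "(\<lambda>x. word_class S R [(x, True)]) \<in> S \<rightarrow> carrier (presented_group S R)"
  by simp

lemma inv_word_class:
  "w \<in> words S \<Longrightarrow> inv\<^bsub>presented_group S R\<^esub> word_class S R w = word_class S R (word_inv w)"
  by (rule presented.inv_equality)
    (auto simp: word_class_append one_presented_group word_class_eq_iff pres_eq_word_inv)

lemma word_class_eq_word_eval:
  "w \<in> words S \<Longrightarrow>
    word_class S R w = word_eval (presented_group S R) (\<lambda>x. word_class S R [(x, True)]) w"
proof (induction w)
  case Nil
  then show ?case
    by (simp add: one_presented_group)
next
  case (Cons p w)
  obtain x e where p: "p = (x, e)"
    by force
  have "word_class S R (p # w) = word_class S R [p] \<otimes>\<^bsub>presented_group S R\<^esub> word_class S R w"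
    using Cons.prems by (simp add: word_class_append)
  moreover have "word_class S R [(x, False)] = inv\<^bsub>presented_group S R\<^esub> word_class S R [(x, True)]"
    using Cons.prems p by (simp add: inv_word_class word_inv_Cons)
  ultimately show ?case
    using Cons p by (simp add: presented.word_eval_Cons)
qed

lemma word_class_relator: "r \<in> R \<Longrightarrow> word_class S R r = \<one>\<^bsub>presented_group S R\<^esub>"
  using relators_in_words pres_relator[of "[]" S "[]" r R]
  by (simp add: one_presented_group word_class_eq_iff subset_iff)

lemma word_eval_pres_eq:
  assumes "group H" and f: "f \<in> S \<rightarrow> carrier H"
    and R: "\<And>r. r \<in> R \<Longrightarrow> word_eval H f r = \<one>\<^bsub>H\<^esub>"
    and "pres_eq S R u v"
  shows "word_eval H f u = word_eval H f v"
proof -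
  interpret H: group H by fact
  show ?thesis
    using assms(4)
  proof (induction rule: pres_eq.induct)
    case (pres_cancel u v x e)
    then have "f x \<in> carrier H"
      using f by auto
    then have "word_eval H f [(x, e), (x, \<not> e)] = \<one>\<^bsub>H\<^esub>"
      by (simp add: H.word_eval_Cons)
    then show ?case
      using pres_cancel f H.word_eval_append[of f S "[(x, e), (x, \<not> e)]" v]
      by (simp add: H.word_eval_append[of f S] H.word_eval_closed[of f S])
  next
    case (pres_relator u v r)
    then show ?case
      using f R relators_in_words
      by (auto simp: H.word_eval_append[of f S] H.word_eval_closed[of f S] subset_iff)
  qed simp_all
qed

text \<open>Von Dyck's theorem. The map evaluates an arbitrary representative of the class; by
  \<open>word_eval_pres_eq\<close> the choice does not affect the value.\<close>

theorem presented_hom_exists: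
  assumes "group H" and f: "f \<in> S \<rightarrow> carrier H"
    and R: "\<And>r. r \<in> R \<Longrightarrow> word_eval H f r = \<one>\<^bsub>H\<^esub>"
  obtains h where "h \<in> hom (presented_group S R) H"
    and "\<And>w. w \<in> words S \<Longrightarrow> h (word_class S R w) = word_eval H f w"
proof -
  interpret H: group H by fact
  define h where "h a = word_eval H f (SOME w. w \<in> a)" for a
  have h: "h (word_class S R w) = word_eval H f w" if "w \<in> words S" for w
  proof -
    have "(SOME v. v \<in> word_class S R w) \<in> word_class S R w"
      using word_class_self[OF that] by (rule someI)
    then show ?thesis
      using word_eval_pres_eq[OF assms] by (simp add: h_def word_class_def)
  qed
  have "h \<in> hom (presented_group S R) H"
    using f by (intro homI)
      (auto simp: carrier_presented_group word_class_append h H.word_eval_append[of f S]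
        H.word_eval_closed[of f S])
  then show thesis
    using h that by blast
qed

end


section \<open>The lower central series\<close>

context group
begin

text \<open>Conjugation is an automorphism and so distributes over commutators. Hence the generating
  set of each lower central term is invariant under conjugation.\<close>

lemma conj_commutator:
  assumes "g \<in> carrier G" "h \<in> carrier G" "k \<in> carrier G"
  shows "k \<otimes> (g \<otimes> h \<otimes> inv g \<otimes> inv h) \<otimes> inv k =
    (k \<otimes> g \<otimes> inv k) \<otimes> (k \<otimes> h \<otimes> inv k) \<otimes> inv (k \<otimes> g \<otimes> inv k) \<otimes> inv (k \<otimes> h \<otimes> inv k)"
proof -
  \<comment> \<open>Supplies the cancellations inside right-nested products, the normal form
    produced by \<open>m_assoc\<close>.\<close>
  have "inv k \<otimes> (k \<otimes> a) = a" if "a \<in> carrier G" for a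
    using assms that by (simp add: m_assoc[symmetric])
  then show ?thesis
    using assms by (simp add: m_assoc inv_mult_group)
qed

text \<open>Normality of one term makes the commutators generating the next one closed under
  conjugation. The induction has two base cases because the numbering starts at 1.\<close>

lemma lower_central_normal: "lower_central G n \<lhd> G"
proof (induction n rule: induct_nat_012)
  case (ge2 n)
  then interpret N: normal "lower_central G (Suc n)" G
    by simp
  show ?case
    unfolding lower_central.simps
  proof (rule normal_generateI)
    show "(\<Union>g\<in>carrier G. \<Union>h\<in>lower_central G (Suc n). {g \<otimes> h \<otimes> inv g \<otimes> inv h}) \<subseteq> carrier G"
      using N.subset by auto
  next
    fix c k
    assume "c \<in> (\<Union>g\<in>carrier G. \<Union>h\<in>lower_central G (Suc n). {g \<otimes> h \<otimes> inv g \<otimes> inv h})"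
      and k: "k \<in> carrier G"
    then obtain g h where gh: "g \<in> carrier G" "h \<in> lower_central G (Suc n)"
      and c: "c = g \<otimes> h \<otimes> inv g \<otimes> inv h"
      by blast
    have "k \<otimes> g \<otimes> inv k \<in> carrier G" "k \<otimes> h \<otimes> inv k \<in> lower_central G (Suc n)"
      using gh k N.inv_op_closed2 by auto
    then show "k \<otimes> c \<otimes> inv k \<in>
        (\<Union>g\<in>carrier G. \<Union>h\<in>lower_central G (Suc n). {g \<otimes> h \<otimes> inv g \<otimes> inv h})"
      unfolding c using gh k N.subset by (subst conj_commutator) auto
  qed
qed (auto intro: normal_invI subgroup_self)

lemma lower_central_subgroup: "subgroup (lower_central G n) G"
  using lower_central_normal by (rule normal_imp_subgroup)

lemma lower_central_subset: "lower_central G n \<subseteq> carrier G"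
  using lower_central_subgroup by (rule subgroup.subset)

lemma commutator_in_lower_central:
  "g \<in> carrier G \<Longrightarrow> h \<in> lower_central G (Suc n) \<Longrightarrow>
    g \<otimes> h \<otimes> inv g \<otimes> inv h \<in> lower_central G (Suc (Suc n))"
  by (auto intro: generate.incl)

lemma nilpotent_quotient_group: "group (nilpotent_quotient G n)"
  unfolding nilpotent_quotient_def
  using lower_central_normal by (rule normal.factorgroup_is_group)

lemma quotient_image_group_hom: "group_hom G (nilpotent_quotient G n) (quotient_image G n)"
  unfolding group_hom_def group_hom_axioms_def
  using is_group nilpotent_quotient_group normal.r_coset_hom_Mod[OF lower_central_normal]
  by (simp add: nilpotent_quotient_def quotient_image_def[abs_def])

lemma quotient_image_surj: "quotient_image G n ` carrier G = carrier (nilpotent_quotient G n)"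
  by (simp add: nilpotent_quotient_def quotient_image_def[abs_def] carrier_FactGroup)

lemma one_nilpotent_quotient: "\<one>\<^bsub>nilpotent_quotient G n\<^esub> = lower_central G n"
  by (simp add: nilpotent_quotient_def)

lemma quotient_image_eq_one_iff:
  assumes "g \<in> carrier G"
  shows "quotient_image G n g = \<one>\<^bsub>nilpotent_quotient G n\<^esub> \<longleftrightarrow> g \<in> lower_central G n"
  using assms lower_central_subgroup coset_join1 coset_join2
  by (auto simp: quotient_image_def one_nilpotent_quotient)

lemma quotient_image_eqD:
  assumes "u \<in> carrier G" "v \<in> carrier G" "quotient_image G n u = quotient_image G n v"
  obtains c where "c \<in> lower_central G n" "u = c \<otimes> v"
proof -
  have "u \<in> lower_central G n #> v"
    using assms(3) rcos_self[OF assms(1) lower_central_subgroup, of n]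
    by (simp add: quotient_image_def)
  then show thesis
    using that by (auto simp: r_coset_def)
qed

text \<open>Elements of \<open>G\<^sub>k\<close> are central modulo \<open>G\<^bsub>k+1\<^esub>\<close>, so conjugation by \<open>u\<close> modulo \<open>G\<^bsub>k+1\<^esub>\<close>
  depends only on \<open>u\<close> modulo \<open>G\<^sub>k\<close>.\<close>

lemma quotient_image_conj_cong:
  assumes u: "u \<in> carrier G" and v: "v \<in> carrier G" and x: "x \<in> carrier G"
    and eq: "quotient_image G (Suc k) u = quotient_image G (Suc k) v"
  shows "quotient_image G (Suc (Suc k)) (inv u \<otimes> x \<otimes> u) =
    quotient_image G (Suc (Suc k)) (inv v \<otimes> x \<otimes> v)"
proof -
  obtain c where c: "c \<in> lower_central G (Suc k)" and uc: "u = c \<otimes> v"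
    using quotient_image_eqD[OF u v eq] .
  have cc: "c \<in> carrier G"
    using c lower_central_subset by blast
  interpret Q: group_hom G "nilpotent_quotient G (Suc (Suc k))" "quotient_image G (Suc (Suc k))"
    by (rule quotient_image_group_hom)
  let ?q = "quotient_image G (Suc (Suc k))" and ?Q = "nilpotent_quotient G (Suc (Suc k))"
  \<comment> \<open>The commutator of \<open>x\<close> and \<open>c\<close> lies in the next lower
    central term, so the images of \<open>x\<close> and \<open>c\<close> commute in
    \<open>?Q\<close>.\<close>
  have "?q (x \<otimes> c \<otimes> inv x \<otimes> inv c) = \<one>\<^bsub>?Q\<^esub>"
    using c cc x commutator_in_lower_central by (subst quotient_image_eq_one_iff) auto
  moreover have "x \<otimes> c = (x \<otimes> c \<otimes> inv x \<otimes> inv c) \<otimes> (c \<otimes> x)"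
    using cc x by (simp add: m_assoc) (simp add: m_assoc[symmetric])
  ultimately have "?q (x \<otimes> c) = ?q (c \<otimes> x)"
    using cc x by (metis Q.H.l_one Q.hom_closed Q.hom_mult inv_closed m_closed)
  then have "?q (inv c \<otimes> (x \<otimes> c)) = ?q (inv c \<otimes> (c \<otimes> x))"
    using cc x by simp
  then have "?q (inv c \<otimes> x \<otimes> c) = ?q x"
    using cc x by (simp add: m_assoc[symmetric])
  then have "?q (inv v \<otimes> (inv c \<otimes> x \<otimes> c) \<otimes> v) = ?q (inv v \<otimes> x \<otimes> v)"
    using cc x v by simp
  \<comment> \<open>As \<open>u\<close> is \<open>c\<close> times \<open>v\<close>, conjugation by
    \<open>u\<close> is conjugation by \<open>c\<close>, which is trivial on \<open>x\<close> in
    \<open>?Q\<close>, followed by conjugation by \<open>v\<close>.\<close>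
  moreover have "inv u \<otimes> x \<otimes> u = inv v \<otimes> (inv c \<otimes> x \<otimes> c) \<otimes> v"
    using cc x v by (simp add: uc m_assoc inv_mult_group)
  ultimately show ?thesis
    by simp
qed

end

section \<open>Behaviour of the lower central series under homomorphisms\<close>

context group_hom
begin

lemma hom_lower_central: "h ` lower_central G n \<subseteq> lower_central H n"
proof (induction n rule: induct_nat_012)
  case (ge2 n)
  let ?C = "\<Union>a\<in>carrier G. \<Union>b\<in>lower_central G (Suc n). {a \<otimes> b \<otimes> inv a \<otimes> inv b}"
  have C: "?C \<subseteq> carrier G"
    using G.lower_central_subset[of "Suc n"] by auto
  have "h ` ?C \<subseteq> lower_central H (Suc (Suc n))"
  proof clarify
    fix a b assume ab: "a \<in> carrier G" "b \<in> lower_central G (Suc n)"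
    then have "b \<in> carrier G" "h b \<in> lower_central H (Suc n)"
      using G.lower_central_subset ge2 by blast+
    then show "h (a \<otimes> b \<otimes> inv a \<otimes> inv b) \<in> lower_central H (Suc (Suc n))"
      using ab H.commutator_in_lower_central[of "h a" "h b" n] by (simp del: lower_central.simps)
  qed
  then have "generate H (h ` ?C) \<subseteq> lower_central H (Suc (Suc n))"
    by (rule H.generate_subgroup_incl[OF _ H.lower_central_subgroup])
  then show ?case
    by (simp add: generate_img[OF C])
qed auto

text \<open>Surjectivity lifts both entries of every generating commutator to \<open>G\<close>, and
  the image of a subgroup is a subgroup.\<close>

lemma lower_central_surj:
  assumes surj: "h ` carrier G = carrier H"
  shows "lower_central H n \<subseteq> h ` lower_central G n"
proof (induction n rule: induct_nat_012)
  case (ge2 n)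
  let ?C = "\<Union>a\<in>carrier H. \<Union>b\<in>lower_central H (Suc n). {a \<otimes>\<^bsub>H\<^esub> b \<otimes>\<^bsub>H\<^esub> inv\<^bsub>H\<^esub> a \<otimes>\<^bsub>H\<^esub> inv\<^bsub>H\<^esub> b}"
  have "?C \<subseteq> h ` lower_central G (Suc (Suc n))"
  proof clarify
    fix a b assume "a \<in> carrier H" "b \<in> lower_central H (Suc n)"
    then obtain a' b' where ab: "a' \<in> carrier G" "a = h a'" "b' \<in> lower_central G (Suc n)" "b = h b'"
      using surj ge2 by blast
    moreover have "b' \<in> carrier G"
      using ab G.lower_central_subset by blast
    ultimately show "a \<otimes>\<^bsub>H\<^esub> b \<otimes>\<^bsub>H\<^esub> inv\<^bsub>H\<^esub> a \<otimes>\<^bsub>H\<^esub> inv\<^bsub>H\<^esub> b \<in> h ` lower_central G (Suc (Suc n))"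
      using G.commutator_in_lower_central[of a' b' n]
      by (intro image_eqI[of _ _ "a' \<otimes> b' \<otimes> inv a' \<otimes> inv b'"]) (simp_all del: lower_central.simps)
  qed
  then have "generate H ?C \<subseteq> h ` lower_central G (Suc (Suc n))"
    by (rule H.generate_subgroup_incl[OF _ subgroup_img_is_subgroup[OF G.lower_central_subgroup]])
  then show ?case
    by simp
qed (simp_all add: surj)

end

section \<open>Nilpotency of quotients\<close>

context group
begin

text \<open>Nilpotency passes to quotients. It is needed for the intermediate quotients of the
  Milnor group, into which the link group is mapped.\<close>

lemma lower_central_trivial_quotient:
  assumes "lower_central G n = {\<one>}"
  shows "lower_central (nilpotent_quotient G k) n = {\<one>\<^bsub>nilpotent_quotient G k\<^esub>}"
proof -
  interpret Q: group_hom G "nilpotent_quotient G k" "quotient_image G k"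
    by (rule quotient_image_group_hom)
  show ?thesis
    using Q.lower_central_surj[OF quotient_image_surj, of n] assms
      subgroup.one_closed[OF Q.H.lower_central_subgroup] by auto
qed

lemma lower_central_nilpotent_quotient:
  "lower_central (nilpotent_quotient G n) n = {\<one>\<^bsub>nilpotent_quotient G n\<^esub>}"
proof -
  interpret Q: group_hom G "nilpotent_quotient G n" "quotient_image G n"
    by (rule quotient_image_group_hom)
  have "quotient_image G n g = \<one>\<^bsub>nilpotent_quotient G n\<^esub>" if "g \<in> lower_central G n" for g
    using that lower_central_subset quotient_image_eq_one_iff by blast
  then show ?thesis
    using Q.lower_central_surj[OF quotient_image_surj, of n]
      subgroup.one_closed[OF Q.H.lower_central_subgroup, of n] by blast
qed

text \<open>The end of the inductions along the lower central series: in a nilpotent group,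
  congruence modulo the last term is equality.\<close>

lemma quotient_image_inj:
  assumes "lower_central G n = {\<one>}" "u \<in> carrier G" "v \<in> carrier G"
    and "quotient_image G n u = quotient_image G n v"
  shows "u = v"
  using quotient_image_eqD[OF assms(2-4)] assms(1,3) by auto

text \<open>The start of those inductions: the first term is the whole group, so any two elements
  are congruent.\<close>

lemma quotient_image_1_eq:
  assumes "u \<in> carrier G" "v \<in> carrier G"
  shows "quotient_image G (Suc 0) u = quotient_image G (Suc 0) v"
  using assms coset_join2[OF _ subgroup_self] by (simp add: quotient_image_def)

end


section \<open>Partial longitudes\<close>

text \<open>The combinatorial data on which the group theory is built. For a regular diagram the
  first assumption is \<open>regular_diagram_over_arc_in_arcs\<close>.\<close>

locale based_diagram =
  fixes A :: "('a set \<times> ('a \<Rightarrow> real^2)) set" and \<mu> :: nat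
    and D :: "nat \<Rightarrow> real \<Rightarrow> 'a \<times> real" and b :: "nat \<Rightarrow> nat"
  assumes over_arc_in_arcs:
      "\<And>i j. i < \<mu> \<Longrightarrow> j < num_under \<mu> D i \<Longrightarrow> over_arc \<mu> D i j \<in> arcs \<mu> D"
    and base_arc: "\<And>i. i < \<mu> \<Longrightarrow> (i, b i) \<in> arcs \<mu> D"
begin

definition over_word :: "nat \<Rightarrow> nat \<Rightarrow> (nat \<times> nat) word" where
  "over_word i j = gen_pow (over_arc \<mu> D i j) (crossing_sign A \<mu> D i j)"

definition partial_longitude :: "nat \<Rightarrow> nat \<Rightarrow> (nat \<times> nat) word" where
  "partial_longitude i r = concat (map (\<lambda>s. over_word i ((b i + s) mod num_under \<mu> D i)) [0..<r])"

text \<open>The number of undercrossings passed on the way from the base arc to arc \<open>(i, j)\<close>.\<close>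

definition arc_offset :: "nat \<Rightarrow> nat \<Rightarrow> nat" where
  "arc_offset i j = (j + num_under \<mu> D i - b i) mod num_under \<mu> D i"

lemma partial_longitude_0 [simp]: "partial_longitude i 0 = []"
  by (simp add: partial_longitude_def)

lemma partial_longitude_Suc:
  "partial_longitude i (Suc r) = partial_longitude i r @ over_word i ((b i + r) mod num_under \<mu> D i)"
  by (simp add: partial_longitude_def)

lemma blackboard_longitude_eq:
  "blackboard_longitude A \<mu> D b i = partial_longitude i (num_under \<mu> D i)"
  by (simp add: blackboard_longitude_def partial_longitude_def over_word_def Let_def)

lemma over_word_in_words: "i < \<mu> \<Longrightarrow> j < num_under \<mu> D i \<Longrightarrow> over_word i j \<in> words (arcs \<mu> D)"
  by (simp add: over_word_def over_arc_in_arcs)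

lemma partial_longitude_in_words:
  "i < \<mu> \<Longrightarrow> r \<le> num_under \<mu> D i \<Longrightarrow> partial_longitude i r \<in> words (arcs \<mu> D)"
  by (induction r) (auto simp: partial_longitude_Suc over_word_in_words)

lemma longitude_word_in_words: "i < \<mu> \<Longrightarrow> longitude_word A \<mu> D b i \<in> words (arcs \<mu> D)"
  by (simp add: longitude_word_def blackboard_longitude_eq partial_longitude_in_words base_arc)

lemma arc_in_arcs: "i < \<mu> \<Longrightarrow> j < num_under \<mu> D i \<Longrightarrow> (i, j) \<in> arcs \<mu> D"
  by (simp add: arcs_def)

lemma wirtinger_relator_in_words:
  "i < \<mu> \<Longrightarrow> j < num_under \<mu> D i \<Longrightarrow> wirtinger_relator A \<mu> D i j \<in> words (arcs \<mu> D)"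
  using over_arc_in_arcs[of i j] by (auto simp: wirtinger_relator_def arc_in_arcs)

lemma arc_offset:
  assumes "(i, j) \<in> arcs \<mu> D"
  shows "arc_offset i j \<le> num_under \<mu> D i" "(b i + arc_offset i j) mod num_under \<mu> D i = j"
    and "arc_offset i (b i) = 0"
    and "j < num_under \<mu> D i \<Longrightarrow> arc_offset i j < num_under \<mu> D i"
proof -
  let ?N = "num_under \<mu> D i"
  have "i < \<mu>" "j < max 1 ?N"
    using assms by (auto simp: arcs_def)
  moreover have "b i < max 1 ?N"
    using base_arc[OF \<open>i < \<mu>\<close>] by (simp add: arcs_def)
  \<comment> \<open>Without undercrossings, \<open>j\<close> and \<open>b i\<close> are both 0 and
    \<open>mod 0\<close> is the identity. Otherwise adding \<open>num_under\<close> before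
    subtracting \<open>b i\<close> avoids truncated subtraction.\<close>
  ultimately show "arc_offset i j \<le> ?N" "(b i + arc_offset i j) mod ?N = j" "arc_offset i (b i) = 0"
    by (cases "?N = 0"; auto simp: arc_offset_def mod_add_right_eq less_imp_le)+
  show "j < ?N \<Longrightarrow> arc_offset i j < ?N"
    by (simp add: arc_offset_def)
qed

lemma arc_offset_add:
  assumes "i < \<mu>" "r < num_under \<mu> D i"
  shows "arc_offset i ((b i + r) mod num_under \<mu> D i) = r"
proof -
  let ?N = "num_under \<mu> D i"
  have b: "b i < ?N"
    using base_arc[OF assms(1)] assms(2) by (simp add: arcs_def)
  show ?thesis
  proof (cases "b i + r < ?N")
    case True
    then show ?thesis
      using assms by (simp add: arc_offset_def)
  next
    case False
    \<comment> \<open>Both \<open>b i\<close> and \<open>r\<close> are below \<open>?N\<close>, so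
      the sum wraps around only once.\<close>
    then have "(b i + r) mod ?N = b i + r - ?N"
      using b assms(2) by (simp add: le_mod_geq)
    then show ?thesis
      using False assms b by (simp add: arc_offset_def)
  qed
qed

sublocale wirtinger: presentation "arcs \<mu> D" "wirtinger_relators A \<mu> D"
  by unfold_locales (auto simp: wirtinger_relators_def wirtinger_relator_in_words)

section \<open>Wirtinger relations as conjugation equations\<close>

lemma wirtinger_relator_eval_iff:
  assumes "group H" and f: "f \<in> arcs \<mu> D \<rightarrow> carrier H" and ij: "i < \<mu>" "j < num_under \<mu> D i"
  shows "word_eval H f (wirtinger_relator A \<mu> D i j) = \<one>\<^bsub>H\<^esub> \<longleftrightarrow>
    f (i, (j + 1) mod num_under \<mu> D i) =
      inv\<^bsub>H\<^esub> word_eval H f (over_word i j) \<otimes>\<^bsub>H\<^esub> f (i, j) \<otimes>\<^bsub>H\<^esub> word_eval H f (over_word i j)"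
proof -
  interpret H: group H by fact
  let ?o = "over_arc \<mu> D i j" and ?s = "crossing_sign A \<mu> D i j"
  let ?v = "gen_pow ?o (- ?s) @ [((i, j), True)] @ gen_pow ?o ?s"
  let ?a = "((i, (j + 1) mod num_under \<mu> D i), True)"
  have o: "?o \<in> arcs \<mu> D" "f ?o \<in> carrier H"
    using f ij over_arc_in_arcs by auto
  have a: "(i, j) \<in> arcs \<mu> D" "(i, (j + 1) mod num_under \<mu> D i) \<in> arcs \<mu> D"
    using ij by (auto simp: arcs_def)
  have v: "?v \<in> words (arcs \<mu> D)"
    using o a by simp
  have c: "f (i, j) \<in> carrier H" "f (i, (j + 1) mod num_under \<mu> D i) \<in> carrier H"
    "word_eval H f ?v \<in> carrier H"
    using f a H.word_eval_closed[OF f v] by blast+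
  have "word_eval H f ?v =
      inv\<^bsub>H\<^esub> word_eval H f (over_word i j) \<otimes>\<^bsub>H\<^esub> f (i, j) \<otimes>\<^bsub>H\<^esub> word_eval H f (over_word i j)"
    using f a o c by (simp add: H.word_eval_append[OF f] H.word_eval_Cons H.word_eval_gen_pow
      over_word_def H.int_pow_neg H.m_assoc)
  moreover have "word_eval H f (wirtinger_relator A \<mu> D i j) = f (fst ?a) \<otimes>\<^bsub>H\<^esub> inv\<^bsub>H\<^esub> word_eval H f ?v"
    unfolding wirtinger_relator_def
    using a c v by (subst H.word_eval_append[OF f])
      (auto simp: H.word_eval_word_inv[OF f] H.word_eval_Cons simp del: append.simps)
  ultimately show ?thesis
    using c H.inv_solve_right'[of "\<one>\<^bsub>H\<^esub>" "f (fst ?a)" "word_eval H f ?v"] by auto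
qed

text \<open>The Wirtinger relations of component \<open>i\<close>, solved for the arcs by travelling from the base
  arc; the case \<open>r = num_under \<mu> D i\<close> says that the meridian commutes with the longitude.\<close>

lemma wirtinger_relators_eval_iff:
  assumes "group H" and f: "f \<in> arcs \<mu> D \<rightarrow> carrier H"
  shows "(\<forall>w\<in>wirtinger_relators A \<mu> D. word_eval H f w = \<one>\<^bsub>H\<^esub>) \<longleftrightarrow>
    (\<forall>i<\<mu>. \<forall>r\<le>num_under \<mu> D i. f (i, (b i + r) mod num_under \<mu> D i) =
      inv\<^bsub>H\<^esub> word_eval H f (partial_longitude i r) \<otimes>\<^bsub>H\<^esub> f (i, b i) \<otimes>\<^bsub>H\<^esub>
        word_eval H f (partial_longitude i r))" (is "?L \<longleftrightarrow> (\<forall>i<\<mu>. \<forall>r\<le>_. ?P i r)")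
proof -
  interpret H: group H by fact
  \<comment> \<open>Passing one more crossing appends its over word to the partial longitude. Given
    \<open>?P i r\<close>, this turns the formula for \<open>Suc r\<close> into the right-hand side
    of the Wirtinger relation at that crossing.\<close>
  have step: "inv\<^bsub>H\<^esub> word_eval H f (partial_longitude i (Suc r)) \<otimes>\<^bsub>H\<^esub> f (i, b i) \<otimes>\<^bsub>H\<^esub>
        word_eval H f (partial_longitude i (Suc r)) =
      inv\<^bsub>H\<^esub> word_eval H f (over_word i j) \<otimes>\<^bsub>H\<^esub> f (i, j) \<otimes>\<^bsub>H\<^esub> word_eval H f (over_word i j)"
    if "i < \<mu>" "r < num_under \<mu> D i" "?P i r" "j = (b i + r) mod num_under \<mu> D i" for i r j
  proof -
    have "partial_longitude i r \<in> words (arcs \<mu> D)" "over_word i j \<in> words (arcs \<mu> D)"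
      using that by (auto intro: partial_longitude_in_words over_word_in_words)
    moreover from this have "word_eval H f (partial_longitude i r) \<in> carrier H"
      "word_eval H f (over_word i j) \<in> carrier H"
      by (simp_all add: H.word_eval_closed[OF f])
    moreover have "f (i, b i) \<in> carrier H"
      using base_arc[OF that(1)] f by blast
    ultimately show ?thesis
      using that(3,4)
      by (simp add: partial_longitude_Suc H.word_eval_append[OF f] H.inv_mult_group H.m_assoc)
  qed
  show ?thesis
  proof
    assume L: ?L
    show "\<forall>i<\<mu>. \<forall>r\<le>num_under \<mu> D i. ?P i r"
    proof (intro allI impI)
      fix i r assume i: "i < \<mu>" and "r \<le> num_under \<mu> D i"
      then show "?P i r"
      proof (induction r)
        case 0
        have "f (i, b i) \<in> carrier H"
          using base_arc[OF i] f by blast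
        moreover have "b i mod num_under \<mu> D i = b i"
          using base_arc[OF i] by (cases "num_under \<mu> D i = 0") (auto simp: arcs_def)
        ultimately show ?case
          by simp
      next
        case (Suc r)
        let ?j = "(b i + r) mod num_under \<mu> D i"
        have j: "?j < num_under \<mu> D i"
          using Suc.prems by (intro mod_less_divisor) auto
        then have "wirtinger_relator A \<mu> D i ?j \<in> wirtinger_relators A \<mu> D"
          using i unfolding wirtinger_relators_def by blast
        then have "f (i, (?j + 1) mod num_under \<mu> D i) = inv\<^bsub>H\<^esub> word_eval H f (over_word i ?j)
            \<otimes>\<^bsub>H\<^esub> f (i, ?j) \<otimes>\<^bsub>H\<^esub> word_eval H f (over_word i ?j)"
          using L wirtinger_relator_eval_iff[OF assms i j] by blast
        moreover have "(?j + 1) mod num_under \<mu> D i = (b i + Suc r) mod num_under \<mu> D i"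
          by (simp add: mod_Suc_eq)
        ultimately show ?case
          using step[OF i _ Suc.IH refl] Suc.prems i by simp
      qed
    qed
  next
    assume P: "\<forall>i<\<mu>. \<forall>r\<le>num_under \<mu> D i. ?P i r"
    show ?L
    proof
      fix w assume "w \<in> wirtinger_relators A \<mu> D"
      then obtain i j where w: "w = wirtinger_relator A \<mu> D i j" and ij: "i < \<mu>" "j < num_under \<mu> D i"
        by (auto simp: wirtinger_relators_def)
      \<comment> \<open>Every crossing is met on the tour from the base arc, and its relation
        compares \<open>?P i r\<close> with \<open>?P i (Suc r)\<close>. At the last crossing,
        \<open>Suc r\<close> is \<open>num_under\<close>, so the closing equation is used.\<close>
      define r where "r = arc_offset i j"
      have r: "r < num_under \<mu> D i" and j: "j = (b i + r) mod num_under \<mu> D i"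
        using arc_offset[OF arc_in_arcs[OF ij]] ij by (auto simp: r_def)
      have "?P i r" "?P i (Suc r)"
        using P ij(1) r less_imp_le Suc_leI by blast+
      moreover have "(j + 1) mod num_under \<mu> D i = (b i + Suc r) mod num_under \<mu> D i"
        unfolding j by (simp add: mod_Suc_eq)
      ultimately have "f (i, (j + 1) mod num_under \<mu> D i) = inv\<^bsub>H\<^esub> word_eval H f (over_word i j)
          \<otimes>\<^bsub>H\<^esub> f (i, j) \<otimes>\<^bsub>H\<^esub> word_eval H f (over_word i j)"
        using step[OF ij(1) r _ j] by simp
      then show "word_eval H f w = \<one>\<^bsub>H\<^esub>"
        unfolding w using wirtinger_relator_eval_iff[OF assms ij] by blast
    qed
  qed
qed


section \<open>Arcs in nilpotent groups\<close>

text \<open>A fixed point solves the arc equations of \<open>wirtinger_relators_eval_iff\<close>,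
  except that on a component with undercrossings the closing equation at
  \<open>r = num_under\<close> remains.\<close>

definition arc_step ::
    "('c, 'd) monoid_scheme \<Rightarrow> (nat \<Rightarrow> 'c) \<Rightarrow> (nat \<times> nat \<Rightarrow> 'c) \<Rightarrow> nat \<times> nat \<Rightarrow> 'c" where
  "arc_step H x f a = (case a of (i, j) \<Rightarrow>
    inv\<^bsub>H\<^esub> word_eval H f (partial_longitude i (arc_offset i j)) \<otimes>\<^bsub>H\<^esub> x i \<otimes>\<^bsub>H\<^esub>
      word_eval H f (partial_longitude i (arc_offset i j)))"

lemma arc_longitude_in_words:
  assumes "(i, j) \<in> arcs \<mu> D"
  shows "partial_longitude i (arc_offset i j) \<in> words (arcs \<mu> D)"
  using partial_longitude_in_words arc_offset(1)[OF assms] assms by (simp add: arcs_def)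

lemma arc_step_in_subgroup:
  assumes "group H" and K: "subgroup K H" and x: "x \<in> {..<\<mu>} \<rightarrow> K" and f: "f \<in> arcs \<mu> D \<rightarrow> K"
  shows "arc_step H x f \<in> arcs \<mu> D \<rightarrow> K"
proof
  interpret H: group H by fact
  fix a assume "a \<in> arcs \<mu> D"
  moreover obtain i j where a: "a = (i, j)"
    by force
  ultimately have ij: "(i, j) \<in> arcs \<mu> D"
    by simp
  then have "word_eval H f (partial_longitude i (arc_offset i j)) \<in> K"
    using f by (intro H.word_eval_in_subgroup[OF K _ arc_longitude_in_words]) auto
  moreover have "x i \<in> K"
    using ij x by (auto simp: arcs_def)
  ultimately show "arc_step H x f a \<in> K"
    using K by (simp add: arc_step_def a subgroup.m_closed subgroup.m_inv_closed)
qed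

lemma arc_step_base:
  assumes "group H" "x i \<in> carrier H" "i < \<mu>"
  shows "arc_step H x f (i, b i) = x i"
proof -
  interpret H: group H by fact
  show ?thesis
    using assms by (simp add: arc_step_def arc_offset(3)[OF base_arc])
qed

text \<open>Partial longitudes evaluated at \<open>f\<close> and \<open>g\<close> agree modulo the
  given term. They enter only as conjugators, so \<open>quotient_image_conj_cong\<close> gains one
  term.\<close>

lemma arc_step_contraction:
  assumes "group H" and x: "x \<in> {..<\<mu>} \<rightarrow> carrier H"
    and f: "f \<in> arcs \<mu> D \<rightarrow> carrier H" and g: "g \<in> arcs \<mu> D \<rightarrow> carrier H"
    and eq: "\<And>a. a \<in> arcs \<mu> D \<Longrightarrow> quotient_image H (Suc k) (f a) = quotient_image H (Suc k) (g a)"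
    and a: "a \<in> arcs \<mu> D"
  shows "quotient_image H (Suc (Suc k)) (arc_step H x f a) =
    quotient_image H (Suc (Suc k)) (arc_step H x g a)"
proof -
  interpret Q: group_hom H "nilpotent_quotient H (Suc k)" "quotient_image H (Suc k)"
    by (rule group.quotient_image_group_hom) fact
  obtain i j where ij: "a = (i, j)"
    by force
  define w where "w = partial_longitude i (arc_offset i j)"
  have w: "w \<in> words (arcs \<mu> D)"
    using a arc_longitude_in_words by (simp add: ij w_def)
  have "quotient_image H (Suc k) (word_eval H f w) = quotient_image H (Suc k) (word_eval H g w)"
    unfolding Q.hom_word_eval[OF f w] Q.hom_word_eval[OF g w]
    by (rule Q.H.word_eval_cong[OF eq w])
  moreover have "x i \<in> carrier H"
    using a x by (auto simp: ij arcs_def)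
  ultimately show ?thesis
    using Q.G.quotient_image_conj_cong w Q.G.word_eval_closed[OF f] Q.G.word_eval_closed[OF g]
    by (simp add: arc_step_def ij w_def[symmetric])
qed

text \<open>The iteration starts by giving each arc the value of its meridian. Its iterates stay in
  every subgroup containing these values, which later locates the fixed point.\<close>

definition arc_approx :: "('c, 'd) monoid_scheme \<Rightarrow> (nat \<Rightarrow> 'c) \<Rightarrow> nat \<Rightarrow> nat \<times> nat \<Rightarrow> 'c" where
  "arc_approx H x k = (arc_step H x ^^ k) (\<lambda>a. x (fst a))"

lemma arc_approx_0: "arc_approx H x 0 = (\<lambda>a. x (fst a))"
  and arc_approx_Suc: "arc_approx H x (Suc k) = arc_step H x (arc_approx H x k)"
  by (simp_all add: arc_approx_def)

lemma arc_approx_in_subgroup: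
  assumes "group H" "subgroup K H" and x: "x \<in> {..<\<mu>} \<rightarrow> K"
  shows "arc_approx H x k \<in> arcs \<mu> D \<rightarrow> K"
proof (induction k)
  case 0
  then show ?case
    using x by (auto simp: arc_approx_0 arcs_def)
next
  case (Suc k)
  then show ?case
    unfolding arc_approx_Suc by (rule arc_step_in_subgroup[OF assms])
qed

text \<open>Consecutive iterates number \<open>k\<close> and \<open>Suc k\<close> agree modulo term
  \<open>Suc k\<close>. For \<open>k = m\<close> that term is trivial, so iterate \<open>m\<close>
  is fixed.\<close>

lemma arc_fixpoint_exists:
  assumes "group H" and nilpotent: "lower_central H (Suc m) = {\<one>\<^bsub>H\<^esub>}"
    and x: "x \<in> {..<\<mu>} \<rightarrow> carrier H"
  obtains e where "e \<in> arcs \<mu> D \<rightarrow> carrier H"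
    and "\<And>a. a \<in> arcs \<mu> D \<Longrightarrow> arc_step H x e a = e a"
proof -
  interpret H: group H by fact
  note closed = arc_approx_in_subgroup[OF assms(1) H.subgroup_self x]
  have "quotient_image H (Suc k) (arc_approx H x (Suc k) a) =
      quotient_image H (Suc k) (arc_approx H x k a)"
    if "a \<in> arcs \<mu> D" for k a
    using that
  proof (induction k arbitrary: a)
    case 0
    then show ?case
      using closed by (intro H.quotient_image_1_eq) blast+
  next
    case (Suc k)
    show ?case
      using arc_step_contraction[OF assms(1) x closed closed Suc.IH Suc.prems]
      by (simp only: arc_approx_Suc)
  qed
  then have "arc_step H x (arc_approx H x m) a = arc_approx H x m a" if "a \<in> arcs \<mu> D" for a
    using that closed H.quotient_image_inj[OF nilpotent] by (metis PiE arc_approx_Suc)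
  then show thesis
    using that closed by blast
qed

text \<open>This is where uniqueness is used: any fixed point agrees with iterate \<open>k\<close>
  modulo term \<open>Suc k\<close>, hence equals iterate \<open>m\<close>, which lies in
  \<open>K\<close>.\<close>

lemma arc_fixpoint_in_subgroup:
  assumes "group H" and nilpotent: "lower_central H (Suc m) = {\<one>\<^bsub>H\<^esub>}"
    and K: "subgroup K H" and x: "x \<in> {..<\<mu>} \<rightarrow> K"
    and e: "e \<in> arcs \<mu> D \<rightarrow> carrier H"
    and fixed: "\<And>a. a \<in> arcs \<mu> D \<Longrightarrow> arc_step H x e a = e a"
    and "a \<in> arcs \<mu> D"
  shows "e a \<in> K"
proof -
  interpret H: group H by fact
  have x': "x \<in> {..<\<mu>} \<rightarrow> carrier H"
    using x subgroup.subset[OF K] by blast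
  note closed = arc_approx_in_subgroup[OF assms(1) H.subgroup_self x']
  have "quotient_image H (Suc k) (arc_approx H x k a) = quotient_image H (Suc k) (e a)"
    if "a \<in> arcs \<mu> D" for k a
    using that
  proof (induction k arbitrary: a)
    case 0
    then show ?case
      using closed e by (intro H.quotient_image_1_eq) blast+
  next
    case (Suc k)
    show ?case
      using arc_step_contraction[OF assms(1) x' closed e Suc.IH Suc.prems] fixed[OF Suc.prems]
      by (simp only: arc_approx_Suc)
  qed
  then have "arc_approx H x m a = e a"
    using \<open>a \<in> arcs \<mu> D\<close> closed e H.quotient_image_inj[OF nilpotent] by (meson PiE)
  then show ?thesis
    using arc_approx_in_subgroup[OF assms(1) K x, of m] \<open>a \<in> arcs \<mu> D\<close> by (metis PiE)
qed

text \<open>Consequently homomorphisms carry fixed points to fixed points. This is applied to the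
  projections of the link group and of the Milnor group onto their nilpotent quotients.\<close>

lemma hom_arc_step:
  assumes "group_hom H K h" and x: "x \<in> {..<\<mu>} \<rightarrow> carrier H"
    and f: "f \<in> arcs \<mu> D \<rightarrow> carrier H" and a: "a \<in> arcs \<mu> D"
  shows "arc_step K (\<lambda>i. h (x i)) (\<lambda>a. h (f a)) a = h (arc_step H x f a)"
proof -
  interpret group_hom H K h by fact
  obtain i j where ij: "a = (i, j)"
    by force
  have w: "partial_longitude i (arc_offset i j) \<in> words (arcs \<mu> D)"
    using a arc_longitude_in_words by (simp add: ij)
  have "x i \<in> carrier H"
    using a x by (auto simp: ij arcs_def)
  then show ?thesis
    using G.word_eval_closed[OF f w] by (simp add: arc_step_def ij hom_word_eval[OF f w, symmetric])
qed

text \<open>Being fixed gives the arc equations for \<open>r\<close> below \<open>num_under\<close>,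
  and \<open>closing\<close> gives the one at \<open>r = num_under\<close>, where the tour is back
  at the base arc.\<close>

lemma arc_fixpoint_relators:
  assumes "group H" and x: "x \<in> {..<\<mu>} \<rightarrow> carrier H"
    and e: "e \<in> arcs \<mu> D \<rightarrow> carrier H"
    and fixed: "\<And>a. a \<in> arcs \<mu> D \<Longrightarrow> arc_step H x e a = e a"
    and closing: "\<And>i. i < \<mu> \<Longrightarrow>
      inv\<^bsub>H\<^esub> word_eval H e (partial_longitude i (num_under \<mu> D i)) \<otimes>\<^bsub>H\<^esub> x i \<otimes>\<^bsub>H\<^esub>
        word_eval H e (partial_longitude i (num_under \<mu> D i)) = x i"
    and "w \<in> wirtinger_relators A \<mu> D"
  shows "word_eval H e w = \<one>\<^bsub>H\<^esub>"
proof -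
  have base: "e (i, b i) = x i" if "i < \<mu>" for i
    using arc_step_base[of H x i e] fixed[OF base_arc[OF that]] assms(1) x that by auto
  have "e (i, (b i + r) mod num_under \<mu> D i) =
      inv\<^bsub>H\<^esub> word_eval H e (partial_longitude i r) \<otimes>\<^bsub>H\<^esub> e (i, b i) \<otimes>\<^bsub>H\<^esub>
        word_eval H e (partial_longitude i r)"
    if i: "i < \<mu>" and r: "r \<le> num_under \<mu> D i" for i r
  proof (cases "r < num_under \<mu> D i")
    case True
    then have "(i, (b i + r) mod num_under \<mu> D i) \<in> arcs \<mu> D"
      using i by (intro arc_in_arcs mod_less_divisor) auto
    then show ?thesis
      using fixed[of "(i, (b i + r) mod num_under \<mu> D i)"] arc_offset_add[OF i True]
      by (simp add: arc_step_def base[OF i])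
  next
    case False
    then have "r = num_under \<mu> D i"
      using r by simp
    moreover have "(b i + num_under \<mu> D i) mod num_under \<mu> D i = b i"
      using base_arc[OF i] by (cases "num_under \<mu> D i = 0") (auto simp: arcs_def)
    ultimately show ?thesis
      using closing[OF i] base[OF i] by simp
  qed
  then show ?thesis
    using wirtinger_relators_eval_iff[OF assms(1) e] assms(6) by blast
qed


section \<open>The link group\<close>

lemma link_group_group: "group (link_group A \<mu> D)"
  unfolding link_group_def by (rule wirtinger.presented.is_group)

definition arc_class :: "nat \<times> nat \<Rightarrow> (nat \<times> nat) word set" where
  "arc_class a = word_class (arcs \<mu> D) (wirtinger_relators A \<mu> D) [(a, True)]"

lemma arc_class_in_carrier: "arc_class \<in> arcs \<mu> D \<rightarrow> carrier (link_group A \<mu> D)"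
  by (auto simp: arc_class_def link_group_def)

lemma meridian_eq_arc_class: "meridian A \<mu> D b i = arc_class (i, b i)"
  by (simp add: meridian_def arc_class_def)

lemma word_class_eq_arc_class_eval:
  "w \<in> words (arcs \<mu> D) \<Longrightarrow> word_class (arcs \<mu> D) (wirtinger_relators A \<mu> D) w =
    word_eval (link_group A \<mu> D) arc_class w"
  using wirtinger.word_class_eq_word_eval by (simp add: link_group_def arc_class_def[abs_def])

lemma arc_class_relators:
  "w \<in> wirtinger_relators A \<mu> D \<Longrightarrow> word_eval (link_group A \<mu> D) arc_class w = \<one>\<^bsub>link_group A \<mu> D\<^esub>"
  using wirtinger.word_class_relator wirtinger.relators_in_words word_class_eq_arc_class_eval[of w]
  by (simp add: link_group_def subset_iff)

lemma meridian_in_carrier: "meridian A \<mu> D b \<in> {..<\<mu>} \<rightarrow> carrier (link_group A \<mu> D)"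
  using base_arc by (auto simp: meridian_def link_group_def)

lemma longitude_in_carrier: "i < \<mu> \<Longrightarrow> longitude A \<mu> D b i \<in> carrier (link_group A \<mu> D)"
  by (simp add: longitude_def link_group_def longitude_word_in_words)

text \<open>The correction is recorded as an unspecified power \<open>s\<close>: any power commutes
  with the meridian, so conjugating the meridian by the longitude or by the uncorrected word gives
  the same element.\<close>

lemma word_eval_longitude_word:
  assumes "group H" and e: "e \<in> arcs \<mu> D \<rightarrow> carrier H" and i: "i < \<mu>"
  shows "\<exists>s::int. word_eval H e (longitude_word A \<mu> D b i) =
    word_eval H e (partial_longitude i (num_under \<mu> D i)) \<otimes>\<^bsub>H\<^esub> e (i, b i) [^]\<^bsub>H\<^esub> s"
proof -
  interpret H: group H by fact
  have "e (i, b i) \<in> carrier H"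
    using e base_arc[OF i] by blast
  then show ?thesis
    unfolding longitude_word_def blackboard_longitude_eq
    using i base_arc[OF i] partial_longitude_in_words[OF i order_refl]
    by (auto simp: H.word_eval_append[OF e] H.word_eval_gen_pow)
qed

lemma link_group_arc_fixpoint:
  assumes "a \<in> arcs \<mu> D"
  shows "arc_step (link_group A \<mu> D) (meridian A \<mu> D b) arc_class a = arc_class a"
proof -
  obtain i j where a: "a = (i, j)"
    by force
  then have ij: "(i, j) \<in> arcs \<mu> D" "i < \<mu>"
    using assms by (simp_all add: arcs_def)
  have "arc_class (i, (b i + arc_offset i j) mod num_under \<mu> D i) =
      arc_step (link_group A \<mu> D) (meridian A \<mu> D b) arc_class a"
    using wirtinger_relators_eval_iff[OF link_group_group arc_class_in_carrier]
      arc_class_relators ij(2) arc_offset(1)[OF ij(1)]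
    by (simp add: arc_step_def a meridian_eq_arc_class del: One_nat_def)
  then show ?thesis
    using arc_offset(2)[OF ij(1)] a by simp
qed

text \<open>One full tour of the component conjugates the meridian by the uncorrected longitude
  \<open>u\<close> and returns it to itself. The correction is a power of the meridian.\<close>

lemma meridian_longitude_commute:
  assumes i: "i < \<mu>"
  shows "meridian A \<mu> D b i \<otimes>\<^bsub>link_group A \<mu> D\<^esub> longitude A \<mu> D b i =
    longitude A \<mu> D b i \<otimes>\<^bsub>link_group A \<mu> D\<^esub> meridian A \<mu> D b i"
proof -
  let ?G = "link_group A \<mu> D" and ?N = "num_under \<mu> D i"
  interpret G: group ?G
    by (rule link_group_group)
  define u where "u = word_eval ?G arc_class (partial_longitude i ?N)"
  define m where "m = meridian A \<mu> D b i"
  have mg: "m = arc_class (i, b i)"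
    by (simp add: m_def meridian_eq_arc_class)
  have cl: "u \<in> carrier ?G" "m \<in> carrier ?G"
    using G.word_eval_closed[OF arc_class_in_carrier partial_longitude_in_words[OF i order_refl]]
      meridian_in_carrier i
    by (auto simp: u_def m_def)
  have "arc_class (i, (b i + ?N) mod ?N) = inv\<^bsub>?G\<^esub> u \<otimes>\<^bsub>?G\<^esub> m \<otimes>\<^bsub>?G\<^esub> u"
    using wirtinger_relators_eval_iff[OF link_group_group arc_class_in_carrier] arc_class_relators i
    unfolding u_def mg by blast
  moreover have "(b i + ?N) mod ?N = b i"
    using base_arc[OF i] by (cases "?N = 0") (auto simp: arcs_def)
  ultimately have "m = inv\<^bsub>?G\<^esub> u \<otimes>\<^bsub>?G\<^esub> (m \<otimes>\<^bsub>?G\<^esub> u)"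
    using cl by (simp add: mg G.m_assoc)
  then have mu: "u \<otimes>\<^bsub>?G\<^esub> m = m \<otimes>\<^bsub>?G\<^esub> u"
    using cl by (metis G.inv_solve_left G.m_closed)
  obtain s :: int where s: "longitude A \<mu> D b i = u \<otimes>\<^bsub>?G\<^esub> m [^]\<^bsub>?G\<^esub> s"
    using word_eval_longitude_word[OF link_group_group arc_class_in_carrier i]
      longitude_word_in_words[OF i]
    by (auto simp: longitude_def word_class_eq_arc_class_eval u_def mg)
  have "m \<otimes>\<^bsub>?G\<^esub> (u \<otimes>\<^bsub>?G\<^esub> m [^]\<^bsub>?G\<^esub> s) = u \<otimes>\<^bsub>?G\<^esub> (m \<otimes>\<^bsub>?G\<^esub> m [^]\<^bsub>?G\<^esub> s)"
    using cl mu by (simp add: G.m_assoc[symmetric])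
  also have "m \<otimes>\<^bsub>?G\<^esub> m [^]\<^bsub>?G\<^esub> s = m [^]\<^bsub>?G\<^esub> s \<otimes>\<^bsub>?G\<^esub> m"
    using cl G.int_pow_mult[of m 1 s] G.int_pow_mult[of m s 1] by (simp add: add.commute)
  finally show ?thesis
    using cl by (simp add: s m_def[symmetric] G.m_assoc)
qed

text \<open>Provides both the words \<open>l i\<close> and the surjectivity of the isomorphism. The
  arcs generate the quotient and form a fixed point over the meridians, so uniqueness places them in
  \<open>K\<close>.\<close>

lemma nilpotent_quotient_meridian_words:
  assumes "q \<in> carrier (nilpotent_quotient (link_group A \<mu> D) (Suc m))"
  shows "q \<in> word_eval (nilpotent_quotient (link_group A \<mu> D) (Suc m))
    (\<lambda>k. quotient_image (link_group A \<mu> D) (Suc m) (meridian A \<mu> D b k)) ` words {..<\<mu>}"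
    (is "_ \<in> word_eval ?Q ?x ` _")
proof -
  let ?G = "link_group A \<mu> D"
  let ?\<pi> = "quotient_image ?G (Suc m)"
  interpret Q: group_hom ?G ?Q ?\<pi>
    by (rule group.quotient_image_group_hom[OF link_group_group])
  have x: "?x \<in> {..<\<mu>} \<rightarrow> carrier ?Q"
    using meridian_in_carrier Q.hom_closed by blast
  define K where "K = word_eval ?Q ?x ` words {..<\<mu>}"
  have K: "subgroup K ?Q"
    unfolding K_def by (rule Q.H.subgroup_word_eval_image[OF x])
  have xK: "?x k \<in> K" if "k < \<mu>" for k
  proof -
    have "word_eval ?Q ?x [(k, True)] = ?x k"
      using x that by (intro Q.H.word_eval_single) auto
    then show ?thesis
      unfolding K_def using that by (intro image_eqI[of _ _ "[(k, True)]"]) auto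
  qed
  have "?\<pi> (arc_class a) \<in> K" if "a \<in> arcs \<mu> D" for a
  proof (rule arc_fixpoint_in_subgroup[OF Q.H.is_group _ K])
    show "lower_central ?Q (Suc m) = {\<one>\<^bsub>?Q\<^esub>}"
      by (rule Q.G.lower_central_nilpotent_quotient)
    show "arc_step ?Q ?x (\<lambda>a. ?\<pi> (arc_class a)) a = ?\<pi> (arc_class a)" if "a \<in> arcs \<mu> D" for a
      using hom_arc_step[OF Q.group_hom_axioms meridian_in_carrier arc_class_in_carrier that]
        link_group_arc_fixpoint[OF that] by simp
    show "(\<lambda>a. ?\<pi> (arc_class a)) \<in> arcs \<mu> D \<rightarrow> carrier ?Q"
      using arc_class_in_carrier Q.hom_closed by blast
  qed (use xK that in auto)
  moreover obtain w where "w \<in> words (arcs \<mu> D)" "q = ?\<pi> (word_eval ?G arc_class w)"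
    using assms unfolding Q.G.quotient_image_surj[symmetric]
    by (auto simp: link_group_def wirtinger.carrier_presented_group
        word_class_eq_arc_class_eval[unfolded link_group_def])
  ultimately show ?thesis
    unfolding K_def[symmetric] using Q.hom_word_eval[OF arc_class_in_carrier]
      Q.H.word_eval_in_subgroup[OF K, of "arcs \<mu> D"] by auto
qed

text \<open>The only missing Wirtinger condition is obtained one term at a time: the condition
  modulo term \<open>Suc k\<close> yields enough of a homomorphism to compare longitudes there, and
  conjugation then gains a term.\<close>

lemma closing_mod_lower_central:
  assumes "group P" and nilpotent: "lower_central P (Suc m) = {\<one>\<^bsub>P\<^esub>}"
    and x: "x \<in> {..<\<mu>} \<rightarrow> carrier P"
    and e: "e \<in> arcs \<mu> D \<rightarrow> carrier P"
    and fixed: "\<And>a. a \<in> arcs \<mu> D \<Longrightarrow> arc_step P x e a = e a"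
    and rep: "represents_longitudes A \<mu> D b (Suc m) l"
    and commute: "\<And>i. i < \<mu> \<Longrightarrow>
      x i \<otimes>\<^bsub>P\<^esub> word_eval P x (l i) = word_eval P x (l i) \<otimes>\<^bsub>P\<^esub> x i"
    and "i < \<mu>"
  shows "quotient_image P (Suc k)
      (inv\<^bsub>P\<^esub> word_eval P e (partial_longitude i (num_under \<mu> D i)) \<otimes>\<^bsub>P\<^esub> x i \<otimes>\<^bsub>P\<^esub>
        word_eval P e (partial_longitude i (num_under \<mu> D i))) = quotient_image P (Suc k) (x i)"
  using \<open>i < \<mu>\<close>
proof (induction k arbitrary: i)
  interpret P: group P by fact
  case 0
  then show ?case
    using x P.word_eval_closed[OF e partial_longitude_in_words[OF 0 order_refl]]
    by (intro P.quotient_image_1_eq) auto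
next
  case (Suc k)
  let ?Q = "nilpotent_quotient P (Suc k)" and ?\<pi> = "quotient_image P (Suc k)"
  let ?G = "link_group A \<mu> D"
  interpret \<pi>: group_hom P ?Q ?\<pi>
    by (rule group.quotient_image_group_hom) fact
  have e': "(\<lambda>a. ?\<pi> (e a)) \<in> arcs \<mu> D \<rightarrow> carrier ?Q" and x': "(\<lambda>i. ?\<pi> (x i)) \<in> {..<\<mu>} \<rightarrow> carrier ?Q"
    using e x \<pi>.hom_closed by blast+
  \<comment> \<open>The induction hypothesis, for all components at once, is the closing condition
    in \<open>?Q\<close>. The images of \<open>e\<close> therefore satisfy the Wirtinger relations
    and define \<open>\<phi>\<close>.\<close>
  have "word_eval ?Q (\<lambda>a. ?\<pi> (e a)) w = \<one>\<^bsub>?Q\<^esub>" if "w \<in> wirtinger_relators A \<mu> D" for w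
  proof (rule arc_fixpoint_relators[OF \<pi>.H.is_group x' e' _ _ that])
    show "arc_step ?Q (\<lambda>i. ?\<pi> (x i)) (\<lambda>a. ?\<pi> (e a)) a = ?\<pi> (e a)" if "a \<in> arcs \<mu> D" for a
      using hom_arc_step[OF \<pi>.group_hom_axioms x e that] fixed[OF that] by simp
  next
    fix j assume j: "j < \<mu>"
    then have w: "partial_longitude j (num_under \<mu> D j) \<in> words (arcs \<mu> D)"
      by (simp add: partial_longitude_in_words)
    have "x j \<in> carrier P"
      using x j by auto
    then show "inv\<^bsub>?Q\<^esub> word_eval ?Q (\<lambda>a. ?\<pi> (e a)) (partial_longitude j (num_under \<mu> D j)) \<otimes>\<^bsub>?Q\<^esub>
        ?\<pi> (x j) \<otimes>\<^bsub>?Q\<^esub> word_eval ?Q (\<lambda>a. ?\<pi> (e a)) (partial_longitude j (num_under \<mu> D j)) = ?\<pi> (x j)"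
      using Suc.IH[OF j] \<pi>.G.word_eval_closed[OF e w] by (simp add: \<pi>.hom_word_eval[OF e w, symmetric])
  qed
  then obtain \<phi> where "\<phi> \<in> hom ?G ?Q"
    and \<phi>: "\<And>w. w \<in> words (arcs \<mu> D) \<Longrightarrow>
      \<phi> (word_class (arcs \<mu> D) (wirtinger_relators A \<mu> D) w) = ?\<pi> (word_eval P e w)"
    using wirtinger.presented_hom_exists[OF \<pi>.H.is_group e'] \<pi>.hom_word_eval[OF e]
    unfolding link_group_def by metis
  then interpret \<phi>: group_hom ?G ?Q \<phi>
    by (intro group_hom.intro group_hom_axioms.intro link_group_group \<pi>.H.is_group)
  interpret G: group_hom ?G "nilpotent_quotient ?G (Suc m)" "quotient_image ?G (Suc m)"
    by (rule group.quotient_image_group_hom[OF link_group_group])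
  have i: "i < \<mu>" and li: "l i \<in> words {..<\<mu>}"
    using Suc.prems rep by (auto simp: represents_longitudes_def)
  define u where "u = word_eval P e (partial_longitude i (num_under \<mu> D i))"
  define v where "v = word_eval P x (l i)"
  have cl: "u \<in> carrier P" "v \<in> carrier P" "x i \<in> carrier P"
    using \<pi>.G.word_eval_closed[OF e partial_longitude_in_words[OF i order_refl]]
      \<pi>.G.word_eval_closed[OF x li] x i by (auto simp: u_def v_def)
  have base: "e (j, b j) = x j" if "j < \<mu>" for j
    using arc_step_base[of P x j e] fixed[OF base_arc[OF that]] assms(1) x that by auto
  have \<phi>_meridian: "\<phi> (meridian A \<mu> D b j) = ?\<pi> (x j)" if "j < \<mu>" for j
  proof -
    have "word_eval P e [((j, b j), True)] = x j"
      using base[OF that] x that by (subst \<pi>.G.word_eval_single) auto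
    then show ?thesis
      using base_arc[OF that] by (simp add: meridian_def \<phi>)
  qed
  have mer: "word_eval ?G (meridian A \<mu> D b) (l i) \<in> carrier ?G"
    by (rule \<phi>.G.word_eval_closed[OF meridian_in_carrier li])
  have "quotient_image ?G (Suc m) (word_eval ?G (meridian A \<mu> D b) (l i)) =
      quotient_image ?G (Suc m) (longitude A \<mu> D b i)"
    using rep i G.hom_word_eval[OF meridian_in_carrier li] by (simp add: represents_longitudes_def)
  \<comment> \<open>The word \<open>l i\<close> gives the longitude only up to \<open>c\<close>, but
    \<open>\<phi>\<close> kills \<open>c\<close> because \<open>?Q\<close> inherits nilpotency from
    \<open>P\<close>.\<close>
  then obtain c where c: "c \<in> lower_central ?G (Suc m)"
    and "word_eval ?G (meridian A \<mu> D b) (l i) = c \<otimes>\<^bsub>?G\<^esub> longitude A \<mu> D b i"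
    using \<phi>.G.quotient_image_eqD[OF mer longitude_in_carrier[OF i]] by blast
  moreover have "\<phi> c = \<one>\<^bsub>?Q\<^esub>"
    using \<phi>.hom_lower_central[of "Suc m"] c \<pi>.G.lower_central_trivial_quotient[OF nilpotent] by blast
  moreover have "c \<in> carrier ?G"
    using c \<phi>.G.lower_central_subset by blast
  ultimately have "\<phi> (word_eval ?G (meridian A \<mu> D b) (l i)) = \<phi> (longitude A \<mu> D b i)"
    using longitude_in_carrier[OF i] by simp
  moreover have "\<phi> (word_eval ?G (meridian A \<mu> D b) (l i)) = ?\<pi> v"
    unfolding \<phi>.hom_word_eval[OF meridian_in_carrier li] v_def \<pi>.hom_word_eval[OF x li]
    by (rule \<pi>.H.word_eval_cong[OF _ li]) (simp add: \<phi>_meridian)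
  moreover have "\<phi> (longitude A \<mu> D b i) = ?\<pi> (word_eval P e (longitude_word A \<mu> D b i))"
    by (simp add: longitude_def \<phi> longitude_word_in_words[OF i])
  moreover obtain s :: int where "word_eval P e (longitude_word A \<mu> D b i) = u \<otimes>\<^bsub>P\<^esub> x i [^]\<^bsub>P\<^esub> s"
    using word_eval_longitude_word[OF assms(1) e i] by (auto simp: u_def base[OF i])
  ultimately have uv: "?\<pi> (u \<otimes>\<^bsub>P\<^esub> x i [^]\<^bsub>P\<^esub> s) = ?\<pi> v"
    by simp
  define y where "y = x i [^]\<^bsub>P\<^esub> s"
  have y: "y \<in> carrier P" "x i \<otimes>\<^bsub>P\<^esub> y = y \<otimes>\<^bsub>P\<^esub> x i"
    using cl \<pi>.G.int_pow_mult[of "x i" 1 s] \<pi>.G.int_pow_mult[of "x i" s 1]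
    by (simp_all add: y_def add.commute)
  \<comment> \<open>Removing the framing power \<open>y\<close> shows that \<open>u\<close> is
    congruent to \<open>v\<close> times the inverse of \<open>y\<close>, modulo term
    \<open>Suc k\<close>. The conjugates of \<open>x i\<close> are then congruent modulo the next
    term.\<close>
  have "u = (u \<otimes>\<^bsub>P\<^esub> y) \<otimes>\<^bsub>P\<^esub> inv\<^bsub>P\<^esub> y"
    using cl y by (simp add: \<pi>.G.m_assoc)
  then have "?\<pi> u = ?\<pi> (v \<otimes>\<^bsub>P\<^esub> inv\<^bsub>P\<^esub> y)"
    using uv cl y by (metis \<pi>.G.inv_closed \<pi>.G.m_closed \<pi>.hom_mult y_def)
  then have "quotient_image P (Suc (Suc k)) (inv\<^bsub>P\<^esub> u \<otimes>\<^bsub>P\<^esub> x i \<otimes>\<^bsub>P\<^esub> u) =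
      quotient_image P (Suc (Suc k))
        (inv\<^bsub>P\<^esub> (v \<otimes>\<^bsub>P\<^esub> inv\<^bsub>P\<^esub> y) \<otimes>\<^bsub>P\<^esub> x i \<otimes>\<^bsub>P\<^esub> (v \<otimes>\<^bsub>P\<^esub> inv\<^bsub>P\<^esub> y))"
    using cl y by (intro \<pi>.G.quotient_image_conj_cong) auto
  also have "inv\<^bsub>P\<^esub> (v \<otimes>\<^bsub>P\<^esub> inv\<^bsub>P\<^esub> y) \<otimes>\<^bsub>P\<^esub> x i \<otimes>\<^bsub>P\<^esub> (v \<otimes>\<^bsub>P\<^esub> inv\<^bsub>P\<^esub> y) = x i"
  proof -
    \<comment> \<open>The new conjugator fixes \<open>x i\<close>: \<open>v\<close> commutes with it
      by Milnor's relator and \<open>y\<close> is a power of it.\<close>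
    have "x i \<otimes>\<^bsub>P\<^esub> inv\<^bsub>P\<^esub> y = inv\<^bsub>P\<^esub> y \<otimes>\<^bsub>P\<^esub> x i"
      using cl y
      by (metis \<pi>.G.inv_closed \<pi>.G.inv_solve_left \<pi>.G.inv_solve_right \<pi>.G.m_assoc \<pi>.G.m_closed)
    then have "x i \<otimes>\<^bsub>P\<^esub> (v \<otimes>\<^bsub>P\<^esub> inv\<^bsub>P\<^esub> y) = (v \<otimes>\<^bsub>P\<^esub> inv\<^bsub>P\<^esub> y) \<otimes>\<^bsub>P\<^esub> x i"
      using cl y commute[OF i, folded v_def] by (metis \<pi>.G.inv_closed \<pi>.G.m_assoc)
    moreover have "v \<otimes>\<^bsub>P\<^esub> inv\<^bsub>P\<^esub> y \<in> carrier P"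
      using cl y by simp
    ultimately show ?thesis
      using cl(3) by (metis \<pi>.G.inv_closed \<pi>.G.l_inv \<pi>.G.l_one \<pi>.G.m_assoc)
  qed
  finally show ?case
    by (simp add: u_def)
qed

end


section \<open>The Milnor presentation\<close>

lemma milnor_relators_in_words:
  "(\<And>i. i < \<mu> \<Longrightarrow> l i \<in> words {..<\<mu>}) \<Longrightarrow> milnor_relators \<mu> n l \<subseteq> words {..<\<mu>}"
  by (auto simp: milnor_relators_def)

text \<open>The lower central term is the image of that of the free group under the canonical
  surjection, and every word representing an element of the latter is a relator.\<close>

lemma lower_central_milnor_group:
  assumes l: "\<And>i. i < \<mu> \<Longrightarrow> l i \<in> words {..<\<mu>}"
  shows "lower_central (presented_group {..<\<mu>} (milnor_relators \<mu> n l)) n =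
    {\<one>\<^bsub>presented_group {..<\<mu>} (milnor_relators \<mu> n l)\<^esub>}"
proof -
  let ?R = "milnor_relators \<mu> n l"
  let ?P = "presented_group {..<\<mu>} ?R" and ?F = "free_group {..<\<mu>}"
  interpret P: presentation "{..<\<mu>}" ?R
    by unfold_locales (rule milnor_relators_in_words[OF l])
  interpret F: presentation "{..<\<mu>}" "{} :: nat word set"
    by unfold_locales simp
  obtain h where "h \<in> hom ?F ?P"
    and h: "\<And>w. w \<in> words {..<\<mu>} \<Longrightarrow> h (word_class {..<\<mu>} {} w) = word_class {..<\<mu>} ?R w"
    using F.presented_hom_exists[OF P.presented.is_group P.generator_in_carrier]
      P.word_class_eq_word_eval
    unfolding free_group_def by (metis empty_iff)
  then interpret h: group_hom ?F ?P h
    unfolding free_group_def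
    by (intro group_hom.intro group_hom_axioms.intro F.presented.is_group P.presented.is_group)
  have F: "carrier ?F = word_class {..<\<mu>} {} ` words {..<\<mu>}"
    by (simp add: free_group_def F.carrier_presented_group)
  have "h ` carrier ?F = carrier ?P"
    by (auto simp: F P.carrier_presented_group h image_image)
  then have "lower_central ?P n \<subseteq> h ` lower_central ?F n"
    by (rule h.lower_central_surj)
  moreover have "h y = \<one>\<^bsub>?P\<^esub>" if y: "y \<in> lower_central ?F n" for y
  proof -
    obtain w where w: "w \<in> words {..<\<mu>}" "y = word_class {..<\<mu>} {} w"
      using y h.G.lower_central_subset F by blast
    then have "w \<in> ?R"
      using y by (auto simp: milnor_relators_def)
    then show ?thesis
      using w h P.word_class_relator by simp
  qed
  ultimately show ?thesis
    using subgroup.one_closed[OF P.presented.lower_central_subgroup, of n] by blast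
qed

section \<open>The isomorphism with the nilpotent quotient\<close>

context based_diagram
begin

text \<open>Prescribing \<open>h\<close> on all words, rather than on the generators alone, lets the
  values at the longitude words be read off directly.\<close>

theorem milnor_presentation:
  assumes rep: "represents_longitudes A \<mu> D b (Suc m) l"
  shows "\<exists>h\<in>iso (presented_group {..<\<mu>} (milnor_relators \<mu> (Suc m) l))
      (nilpotent_quotient (link_group A \<mu> D) (Suc m)).
    \<forall>w\<in>words {..<\<mu>}. h (word_class {..<\<mu>} (milnor_relators \<mu> (Suc m) l) w) =
      word_eval (nilpotent_quotient (link_group A \<mu> D) (Suc m))
        (\<lambda>k. quotient_image (link_group A \<mu> D) (Suc m) (meridian A \<mu> D b k)) w"
proof -
  let ?R = "milnor_relators \<mu> (Suc m) l"
  let ?P = "presented_group {..<\<mu>} ?R" and ?F = "free_group {..<\<mu>}"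
  let ?G = "link_group A \<mu> D"
  let ?Q = "nilpotent_quotient ?G (Suc m)" and ?\<pi> = "quotient_image ?G (Suc m)"
  let ?y = "\<lambda>k. ?\<pi> (meridian A \<mu> D b k)"
  define x where "x i = word_class {..<\<mu>} ?R [(i, True)]" for i
  have l: "l i \<in> words {..<\<mu>}" "word_eval ?Q ?y (l i) = ?\<pi> (longitude A \<mu> D b i)" if "i < \<mu>" for i
    using rep that by (auto simp: represents_longitudes_def)
  interpret P: presentation "{..<\<mu>}" ?R
    by unfold_locales (rule milnor_relators_in_words[OF l(1)])
  interpret F: presentation "{..<\<mu>}" "{} :: nat word set"
    by unfold_locales simp
  interpret Q: group_hom ?G ?Q ?\<pi>
    by (rule group.quotient_image_group_hom[OF link_group_group])
  have x: "x \<in> {..<\<mu>} \<rightarrow> carrier ?P"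
    by (auto simp: x_def)
  have word_class_x: "word_class {..<\<mu>} ?R w = word_eval ?P x w" if "w \<in> words {..<\<mu>}" for w
    using P.word_class_eq_word_eval[OF that] by (simp add: x_def[abs_def])
  have nilpotent: "lower_central ?P (Suc m) = {\<one>\<^bsub>?P\<^esub>}"
    by (rule lower_central_milnor_group[OF l(1)])
  have y: "?y \<in> {..<\<mu>} \<rightarrow> carrier ?Q"
    using meridian_in_carrier Q.hom_closed by blast

  have "word_eval ?Q ?y r = \<one>\<^bsub>?Q\<^esub>" if "r \<in> ?R" for r
    using that unfolding milnor_relators_def
  proof
    assume "r \<in> {word_comm [(i, True)] (l i) |i. i < \<mu>}"
    then obtain i where i: "i < \<mu>" and r: "r = word_comm [(i, True)] (l i)"
      by blast
    have m: "meridian A \<mu> D b i \<in> carrier ?G"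
      using meridian_in_carrier i by blast
    have "word_eval ?Q ?y [(i, True)] = ?y i"
      using Q.hom_closed[OF m] by (rule Q.H.word_eval_single)
    moreover have "?y i \<otimes>\<^bsub>?Q\<^esub> ?\<pi> (longitude A \<mu> D b i) = ?\<pi> (longitude A \<mu> D b i) \<otimes>\<^bsub>?Q\<^esub> ?y i"
      using meridian_longitude_commute[OF i] m longitude_in_carrier[OF i] Q.hom_mult by metis
    ultimately show ?thesis
      unfolding r using l[OF i] i by (subst Q.H.word_eval_word_comm_eq_one_iff[OF y]) auto
  next
    assume "r \<in> {w \<in> words {..<\<mu>}. word_class {..<\<mu>} {} w \<in> lower_central ?F (Suc m)}"
    then have r: "r \<in> words {..<\<mu>}" "word_class {..<\<mu>} {} r \<in> lower_central ?F (Suc m)"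
      by auto
    \<comment> \<open>Homomorphisms respect lower central terms, and the corresponding term of
      \<open>?Q\<close> is trivial, so these relators vanish.\<close>
    obtain f where "f \<in> hom ?F ?Q"
      and f: "\<And>w. w \<in> words {..<\<mu>} \<Longrightarrow> f (word_class {..<\<mu>} {} w) = word_eval ?Q ?y w"
      using F.presented_hom_exists[OF Q.H.is_group y] unfolding free_group_def by (metis empty_iff)
    then interpret f: group_hom ?F ?Q f
      unfolding free_group_def
      by (intro group_hom.intro group_hom_axioms.intro F.presented.is_group Q.H.is_group)
    show ?thesis
      using f.hom_lower_central[of "Suc m"] r f Q.G.lower_central_nilpotent_quotient[of "Suc m"] by auto
  qed
  then obtain h where "h \<in> hom ?P ?Q"
    and h: "\<And>w. w \<in> words {..<\<mu>} \<Longrightarrow> h (word_class {..<\<mu>} ?R w) = word_eval ?Q ?y w"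
    using P.presented_hom_exists[OF Q.H.is_group y] by metis
  have surj: "h ` carrier ?P = carrier ?Q"
  proof
    show "h ` carrier ?P \<subseteq> carrier ?Q"
      using \<open>h \<in> hom ?P ?Q\<close> by (auto simp: hom_def)
    show "carrier ?Q \<subseteq> h ` carrier ?P"
      using nilpotent_quotient_meridian_words[of _ m] h
      by (auto simp: P.carrier_presented_group image_image)
  qed

  obtain e where e: "e \<in> arcs \<mu> D \<rightarrow> carrier ?P"
    and fixed: "\<And>a. a \<in> arcs \<mu> D \<Longrightarrow> arc_step ?P x e a = e a"
    using arc_fixpoint_exists[OF P.presented.is_group nilpotent x] by blast
  have commute: "x i \<otimes>\<^bsub>?P\<^esub> word_eval ?P x (l i) = word_eval ?P x (l i) \<otimes>\<^bsub>?P\<^esub> x i" if i: "i < \<mu>" for i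
  proof -
    have "word_comm [(i, True)] (l i) \<in> ?R"
      using i by (auto simp: milnor_relators_def)
    then have "word_eval ?P x (word_comm [(i, True)] (l i)) = \<one>\<^bsub>?P\<^esub>"
      using P.word_class_relator P.relators_in_words by (simp add: word_class_x[symmetric] subset_iff)
    moreover have "word_eval ?P x [(i, True)] = x i"
      using x i by (intro P.presented.word_eval_single) auto
    ultimately show ?thesis
      using P.presented.word_eval_word_comm_eq_one_iff[OF x, of "[(i, True)]" "l i"] l(1)[OF i] i by simp
  qed
  have "word_eval ?P e w = \<one>\<^bsub>?P\<^esub>" if "w \<in> wirtinger_relators A \<mu> D" for w
  proof (rule arc_fixpoint_relators[OF P.presented.is_group x e fixed _ that])
    fix i assume i: "i < \<mu>"
    then have "x i \<in> carrier ?P" "word_eval ?P e (partial_longitude i (num_under \<mu> D i)) \<in> carrier ?P"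
      using x P.presented.word_eval_closed[OF e] partial_longitude_in_words by auto
    \<comment> \<open>Taking \<open>k = m\<close> in \<open>closing_mod_lower_central\<close> makes
      the congruence an equality, since that term of \<open>?P\<close> is trivial.\<close>
    then show "inv\<^bsub>?P\<^esub> word_eval ?P e (partial_longitude i (num_under \<mu> D i)) \<otimes>\<^bsub>?P\<^esub> x i \<otimes>\<^bsub>?P\<^esub>
        word_eval ?P e (partial_longitude i (num_under \<mu> D i)) = x i"
      using closing_mod_lower_central[OF P.presented.is_group nilpotent x e fixed rep commute i, of m]
      by (intro P.presented.quotient_image_inj[OF nilpotent]) auto
  qed
  then obtain k where "k \<in> hom ?G ?P"
    and k: "\<And>w. w \<in> words (arcs \<mu> D) \<Longrightarrow>
      k (word_class (arcs \<mu> D) (wirtinger_relators A \<mu> D) w) = word_eval ?P e w"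
    using wirtinger.presented_hom_exists[OF P.presented.is_group e] unfolding link_group_def by metis
  then interpret k: group_hom ?G ?P k
    by (intro group_hom.intro group_hom_axioms.intro link_group_group P.presented.is_group)
  have k_meridian: "k (meridian A \<mu> D b i) = x i" if i: "i < \<mu>" for i
  proof -
    have "e (i, b i) = x i"
      using arc_step_base[OF P.presented.is_group _ i, of x e] fixed[OF base_arc[OF i]] x i by auto
    moreover have "word_eval ?P e [((i, b i), True)] = e (i, b i)"
      using e base_arc[OF i] by (intro P.presented.word_eval_single) auto
    ultimately show ?thesis
      using base_arc[OF i] by (simp add: meridian_def k)
  qed
  \<comment> \<open>The map \<open>k\<close> lives on the link group itself. If \<open>h p\<close>
    is trivial, the word for \<open>p\<close> in the meridians lies in the lower central term, which
    \<open>k\<close> sends to the trivial one; but \<open>k\<close> sends that element to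
    \<open>p\<close>.\<close>
  have "kernel ?P ?Q h \<subseteq> {\<one>\<^bsub>?P\<^esub>}"
  proof
    fix p assume "p \<in> kernel ?P ?Q h"
    then obtain v where v: "v \<in> words {..<\<mu>}" "p = word_class {..<\<mu>} ?R v" and "h p = \<one>\<^bsub>?Q\<^esub>"
      by (auto simp: kernel_def P.carrier_presented_group)
    then have "?\<pi> (word_eval ?G (meridian A \<mu> D b) v) = \<one>\<^bsub>?Q\<^esub>"
      using h Q.hom_word_eval[OF meridian_in_carrier v(1)] by simp
    then have "word_eval ?G (meridian A \<mu> D b) v \<in> lower_central ?G (Suc m)"
      using Q.G.quotient_image_eq_one_iff[OF Q.G.word_eval_closed[OF meridian_in_carrier v(1)]] by blast
    then have "k (word_eval ?G (meridian A \<mu> D b) v) = \<one>\<^bsub>?P\<^esub>"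
      using k.hom_lower_central[of "Suc m"] nilpotent by blast
    moreover have "k (word_eval ?G (meridian A \<mu> D b) v) = word_eval ?P x v"
      unfolding k.hom_word_eval[OF meridian_in_carrier v(1)]
      by (rule P.presented.word_eval_cong[OF _ v(1)]) (simp add: k_meridian)
    ultimately show "p \<in> {\<one>\<^bsub>?P\<^esub>}"
      using v word_class_x by simp
  qed
  moreover have "\<one>\<^bsub>?P\<^esub> \<in> kernel ?P ?Q h"
    using hom_one[OF \<open>h \<in> hom ?P ?Q\<close> P.presented.is_group Q.H.is_group] by (simp add: kernel_def)
  ultimately have "h \<in> iso ?P ?Q"
    using iso_kernel_image[OF P.presented.is_group Q.H.is_group] \<open>h \<in> hom ?P ?Q\<close> surj by blast
  then show ?thesis
    using h by blast
qed

lemma represents_longitudes_exists: "\<exists>l. represents_longitudes A \<mu> D b (Suc m) l"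
proof -
  let ?Q = "nilpotent_quotient (link_group A \<mu> D) (Suc m)"
    and ?\<pi> = "quotient_image (link_group A \<mu> D) (Suc m)"
  have "\<exists>w\<in>words {..<\<mu>}. word_eval ?Q (\<lambda>k. ?\<pi> (meridian A \<mu> D b k)) w = ?\<pi> (longitude A \<mu> D b i)"
    if "i < \<mu>" for i
  proof -
    have "?\<pi> (longitude A \<mu> D b i) \<in> carrier ?Q"
      using longitude_in_carrier[OF that] group.quotient_image_surj[OF link_group_group] by blast
    from nilpotent_quotient_meridian_words[OF this] show ?thesis
      by force
  qed
  then show ?thesis
    unfolding represents_longitudes_def by metis
qed

end

text \<open>General position gives each double point a unique partner, so the description defining
  \<open>over_strand\<close> really denotes it.\<close>

lemma regular_diagram_over_arc_in_arcs:
  assumes D: "regular_diagram X A \<mu> D" and i: "i < \<mu>" and j: "j < num_under \<mu> D i"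
  shows "over_arc \<mu> D i j \<in> arcs \<mu> D"
proof -
  let ?U = "undercrossings \<mu> D i"
  \<comment> \<open>An infinite set has cardinality 0, so an index below the cardinality forces
    finiteness.\<close>
  have "finite ?U"
    using j by (auto simp: num_under_def intro: card_ge_0_finite)
  then have "under_param \<mu> D i j \<in> ?U"
    using j nth_mem[of j "sorted_list_of_set ?U"] by (simp add: under_param_def num_under_def)
  then obtain q where q: "((i, under_param \<mu> D i j), q) \<in> double_points \<mu> D"
    by (auto simp: undercrossings_def)
  then have "over_strand \<mu> D i j = q"
    using D unfolding over_strand_def regular_diagram_def by (intro the_equality) blast+
  moreover obtain k t where "q = (k, t)"
    by force
  moreover have "k < \<mu>"
    using q \<open>q = (k, t)\<close> by (auto simp: double_points_def params_def)
  \<comment> \<open>Finiteness makes \<open>num_under = 0\<close> mean that there are no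
    undercrossings. Then \<open>mod 0\<close> leaves the count unchanged, and that count is
    0.\<close>
  moreover have "finite (undercrossings \<mu> D k)"
  proof (rule finite_subset)
    show "undercrossings \<mu> D k \<subseteq> (\<lambda>p. snd (fst p)) ` double_points \<mu> D"
      by (force simp: undercrossings_def)
    show "finite ((\<lambda>p. snd (fst p)) ` double_points \<mu> D)"
      using D by (simp add: regular_diagram_def)
  qed
  then have "card {u \<in> undercrossings \<mu> D k. u < t} mod num_under \<mu> D k < max 1 (num_under \<mu> D k)"
    by (cases "num_under \<mu> D k = 0") (simp add: num_under_def, simp add: less_max_iff_disj)
  ultimately show ?thesis
    by (simp add: over_arc_def arc_at_def arcs_def)
qed

text \<open>The presentation is expressed by an isomorphism with prescribed values on meridians and
  longitudes. The first conjunct keeps the statement about all admissible \<open>l\<close> from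
  being vacuous.\<close>

theorem theorem3p6:
  fixes X :: "'a topology"
    and A :: "('a set \<times> ('a \<Rightarrow> real^2)) set"
    and L D :: "nat \<Rightarrow> real \<Rightarrow> 'a \<times> real"
    and b :: "nat \<Rightarrow> nat"
    and \<mu> n :: nat
  assumes surface: "closed_connected_oriented_surface X A"
    and link: "oriented_link X \<mu> L"
    and diagram: "diagram_of X A \<mu> L D"
    and basearcs: "\<And>i. i < \<mu> \<Longrightarrow> (i, b i) \<in> arcs \<mu> D"
    and n: "n \<ge> 1"
  shows "(\<exists>l. represents_longitudes A \<mu> D b n l) \<and>
    (\<forall>l. represents_longitudes A \<mu> D b n l \<longrightarrow>
      (\<exists>h \<in> iso (presented_group {..<\<mu>} (milnor_relators \<mu> n l))
                 (nilpotent_quotient (link_group A \<mu> D) n).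
         \<forall>i<\<mu>. h (word_class {..<\<mu>} (milnor_relators \<mu> n l) [(i, True)]) =
                quotient_image (link_group A \<mu> D) n (meridian A \<mu> D b i) \<and>
               h (word_class {..<\<mu>} (milnor_relators \<mu> n l) (l i)) =
                quotient_image (link_group A \<mu> D) n (longitude A \<mu> D b i)))"
proof -
  interpret based_diagram A \<mu> D b
    using diagram basearcs
    by unfold_locales (auto simp: diagram_of_def intro: regular_diagram_over_arc_in_arcs)
  obtain m where m: "n = Suc m"
    using n by (cases n) auto
  let ?G = "link_group A \<mu> D"
  interpret Q: group_hom ?G "nilpotent_quotient ?G n" "quotient_image ?G n"
    by (rule group.quotient_image_group_hom[OF link_group_group])
  have meridian: "word_eval (nilpotent_quotient ?G n) (\<lambda>k. quotient_image ?G n (meridian A \<mu> D b k))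
      [(i, True)] = quotient_image ?G n (meridian A \<mu> D b i)" if "i < \<mu>" for i
    using meridian_in_carrier that by (intro Q.H.word_eval_single Q.hom_closed) auto
  show ?thesis
  proof (intro conjI allI impI)
    show "\<exists>l. represents_longitudes A \<mu> D b n l"
      unfolding m by (rule represents_longitudes_exists)
  next
    fix l assume rep: "represents_longitudes A \<mu> D b n l"
    then have l: "l i \<in> words {..<\<mu>}"
      "word_eval (nilpotent_quotient ?G n) (\<lambda>k. quotient_image ?G n (meridian A \<mu> D b k)) (l i) =
        quotient_image ?G n (longitude A \<mu> D b i)" if "i < \<mu>" for i
      using that by (auto simp: represents_longitudes_def)
    from milnor_presentation[OF rep[unfolded m], folded m] obtain h
      where "h \<in> iso (presented_group {..<\<mu>} (milnor_relators \<mu> n l)) (nilpotent_quotient ?G n)"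
        and h: "\<And>w. w \<in> words {..<\<mu>} \<Longrightarrow> h (word_class {..<\<mu>} (milnor_relators \<mu> n l) w) =
          word_eval (nilpotent_quotient ?G n) (\<lambda>k. quotient_image ?G n (meridian A \<mu> D b k)) w"
      by blast
    then show "\<exists>h \<in> iso (presented_group {..<\<mu>} (milnor_relators \<mu> n l)) (nilpotent_quotient ?G n).
         \<forall>i<\<mu>. h (word_class {..<\<mu>} (milnor_relators \<mu> n l) [(i, True)]) =
                quotient_image ?G n (meridian A \<mu> D b i) \<and>
               h (word_class {..<\<mu>} (milnor_relators \<mu> n l) (l i)) =
                quotient_image ?G n (longitude A \<mu> D b i)"
      using l meridian by (intro bexI[of _ h]) simp_all
  qed
qed

end
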